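(* Let $k$ be a field of characteristic zero, let $r\ge 1$ and $d\ge 1$ be integers, and let $X_{r,d}$ be the affine cone over $V_{r,d}\subset\mathbb{P}^n_k$, the image of the $d$th Veronese embedding of $\mathbb{P}^r_k$ (so $n=\binom{r+d}{d}-1$). Then $\Omega_{X_{r,d}}$ has torsion if and only if $d\geq 3$.
   Context: The $d$th Veronese embedding $v_d\colon\mathbb{P}^r_k\to\mathbb{P}^n_k$, $n=\binom{r+d}{d}-1$, is given by all monomials of degree $d$ in the homogeneous coordinates $x_0,\dots,x_r$. The affine cone over $V_{r,d}=v_d(\mathbb{P}^r_k)$ is the spectrum of the homogeneous coordinate ring of $V_{r,d}$; thus $X_{r,d}\cong\operatorname{Spec} R$, where $R\subset k[x_0,\dots,x_r]$ is the $k$-subalgebra generated by all monomials of degree $d$. $\Omega_{X_{r,d}}=\Omega_{X_{r,d}/k}$ is the sheaf of Kähler differentials over $k$; it has torsion if its torsion subsheaf, i.e. the kernel of the natural map $\Omega_{X_{r,d}}\to\Omega_{X_{r,d}}^{\vee\vee}$ to its double dual, is nonzero. *)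

theory Defs
  imports "HOL-Algebra.Algebra" "HOL-Algebra.Algebraic_Closure_Type" "HOL-Library.Poly_Mapping"
begin

section \<open>Modules over a commutative ring\<close>

text \<open>
  The record \<^typ>\<open>('a, 'b) module\<close> extends the ring record, so it carries fields
  \<open>mult\<close> and \<open>one\<close> which play no role in the locale \<^locale>\<open>module\<close>;
  they are left undefined below.
\<close>

text \<open>Finitely supported functions on \<open>I\<close>, extended by zero outside of \<open>I\<close>.\<close>

definition free_module :: "('a, 'm) ring_scheme \<Rightarrow> 'i set \<Rightarrow> ('a, 'i \<Rightarrow> 'a) module"
  where "free_module R I =
    \<lparr>carrier = {f. (\<forall>i\<in>I. f i \<in> carrier R) \<and> (\<forall>i. i \<notin> I \<longrightarrow> f i = \<zero>\<^bsub>R\<^esub>) \<and> finite {i. f i \<noteq> \<zero>\<^bsub>R\<^esub>}},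
     monoid.mult = undefined, one = undefined,
     ring.zero = (\<lambda>i. \<zero>\<^bsub>R\<^esub>),
     add = (\<lambda>f g i. f i \<oplus>\<^bsub>R\<^esub> g i),
     module.smult = (\<lambda>a f i. a \<otimes>\<^bsub>R\<^esub> f i)\<rparr>"

definition free_basis :: "('a, 'm) ring_scheme \<Rightarrow> 'i \<Rightarrow> 'i \<Rightarrow> 'a"
  where "free_basis R i = (\<lambda>j. if j = i then \<one>\<^bsub>R\<^esub> else \<zero>\<^bsub>R\<^esub>)"

definition submodule_generated ::
    "('a, 'm) ring_scheme \<Rightarrow> ('a, 'b, 'n) module_scheme \<Rightarrow> 'b set \<Rightarrow> 'b set"
  where "submodule_generated R M G = (\<lambda>N. submodule N R M) hull G"

text \<open>The analogue of \<^const>\<open>FactRing\<close> for modules.\<close>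

definition quotient_module ::
    "('a, 'b, 'n) module_scheme \<Rightarrow> 'b set \<Rightarrow> ('a, 'b set) module"
  where "quotient_module M N =
    \<lparr>carrier = a_rcosets\<^bsub>M\<^esub> N,
     monoid.mult = undefined, one = undefined,
     ring.zero = N,
     add = set_add M,
     module.smult = (\<lambda>a C. \<Union>x\<in>C. N +>\<^bsub>M\<^esub> (a \<odot>\<^bsub>M\<^esub> x))\<rparr>"

text \<open>
  \<open>Hom\<^sub>R(M, R)\<close>; linear forms are extensional, so that two of them are equal as soon as they
  agree on the carrier of \<open>M\<close>.
\<close>

definition dual_module ::
    "('a, 'm) ring_scheme \<Rightarrow> ('a, 'b, 'n) module_scheme \<Rightarrow> ('a, 'b \<Rightarrow> 'a) module"
  where "dual_module R M =
    \<lparr>carrier = {f \<in> carrier M \<rightarrow>\<^sub>E carrier R.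
        (\<forall>x\<in>carrier M. \<forall>y\<in>carrier M. f (x \<oplus>\<^bsub>M\<^esub> y) = f x \<oplus>\<^bsub>R\<^esub> f y) \<and>
        (\<forall>a\<in>carrier R. \<forall>x\<in>carrier M. f (a \<odot>\<^bsub>M\<^esub> x) = a \<otimes>\<^bsub>R\<^esub> f x)},
     monoid.mult = undefined, one = undefined,
     ring.zero = (\<lambda>x\<in>carrier M. \<zero>\<^bsub>R\<^esub>),
     add = (\<lambda>f g. \<lambda>x\<in>carrier M. f x \<oplus>\<^bsub>R\<^esub> g x),
     module.smult = (\<lambda>a f. \<lambda>x\<in>carrier M. a \<otimes>\<^bsub>R\<^esub> f x)\<rparr>"

definition bidual_map ::
    "('a, 'm) ring_scheme \<Rightarrow> ('a, 'b, 'n) module_scheme \<Rightarrow> 'b \<Rightarrow> ('b \<Rightarrow> 'a) \<Rightarrow> 'a"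
  where "bidual_map R M x = (\<lambda>f\<in>carrier (dual_module R M). f x)"

text \<open>
  For \<open>R\<close> Noetherian and \<open>M\<close> finitely generated, the torsion subsheaf of the sheaf associated with
  \<open>M\<close> on \<open>Spec R\<close> is the sheaf associated with this submodule, so one is zero iff the other is.
\<close>

definition torsion_submodule ::
    "('a, 'm) ring_scheme \<Rightarrow> ('a, 'b, 'n) module_scheme \<Rightarrow> 'b set"
  where "torsion_submodule R M =
    a_kernel M (dual_module R (dual_module R M)) (bidual_map R M)"

definition has_torsion :: "('a, 'm) ring_scheme \<Rightarrow> ('a, 'b, 'n) module_scheme \<Rightarrow> bool"
  where "has_torsion R M \<longleftrightarrow> torsion_submodule R M \<noteq> {\<zero>\<^bsub>M\<^esub>}"


section \<open>Kaehler differentials\<close>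

text \<open>
  For a \<open>K\<close>-algebra \<open>A\<close> in the sense of the locale \<^locale>\<open>algebra\<close>, the module of differentials
  of \<open>A\<close> over \<open>K\<close> is the free \<open>A\<close>-module on symbols \<open>dx\<close>, \<open>x \<in> A\<close>, modulo additivity, the
  Leibniz rule, and \<open>d(c \<cdot> 1) = 0\<close> for \<open>c \<in> K\<close>. The scalar multiplication of \<open>A\<close> itself is the
  action of \<open>K\<close>, that of \<open>free_module A _\<close> is the action of \<open>A\<close>.
\<close>

definition kaehler_relations ::
    "('k, 'm) ring_scheme \<Rightarrow> ('k, 'a, 'n) module_scheme \<Rightarrow> ('a \<Rightarrow> 'a) set"
  where "kaehler_relations K A =
    (let F = free_module A (carrier A); d = free_basis A in
       {d (x \<oplus>\<^bsub>A\<^esub> y) \<ominus>\<^bsub>F\<^esub> (d x \<oplus>\<^bsub>F\<^esub> d y) | x y. x \<in> carrier A \<and> y \<in> carrier A} \<union>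
       {d (x \<otimes>\<^bsub>A\<^esub> y) \<ominus>\<^bsub>F\<^esub> (x \<odot>\<^bsub>F\<^esub> d y \<oplus>\<^bsub>F\<^esub> y \<odot>\<^bsub>F\<^esub> d x) | x y. x \<in> carrier A \<and> y \<in> carrier A} \<union>
       {d (c \<odot>\<^bsub>A\<^esub> \<one>\<^bsub>A\<^esub>) | c. c \<in> carrier K})"

definition kaehler_differentials ::
    "('k, 'm) ring_scheme \<Rightarrow> ('k, 'a, 'n) module_scheme \<Rightarrow> ('a, ('a \<Rightarrow> 'a) set) module"
  where "kaehler_differentials K A =
    (let F = free_module A (carrier A) in
       quotient_module F (submodule_generated A F (kaehler_relations K A)))"


section \<open>The homogeneous coordinate ring of a Veronese variety\<close>

text \<open>
  The type \<^typ>\<open>(nat \<Rightarrow>\<^sub>0 nat) \<Rightarrow>\<^sub>0 'k\<close> is the polynomial ring over \<open>'k\<close> in countably many variables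
  \<open>x\<^sub>0, x\<^sub>1, \<dots>\<close>: exponent vectors are mapped to coefficients.
\<close>

definition veronese_monomials :: "nat \<Rightarrow> nat \<Rightarrow> ((nat \<Rightarrow>\<^sub>0 nat) \<Rightarrow>\<^sub>0 'k::field) set"
  where "veronese_monomials r d =
    {Poly_Mapping.single m 1 | m. Poly_Mapping.keys m \<subseteq> {..r} \<and> (\<Sum>i\<le>r. Poly_Mapping.lookup m i) = d}"

text \<open>
  The subalgebra of \<open>k[x\<^sub>0, \<dots>, x\<^sub>r]\<close> generated by the monomials of degree \<open>d\<close>, as a subring
  generated by these and the constants.
\<close>

definition veronese_algebra :: "nat \<Rightarrow> nat \<Rightarrow> ('k::field, (nat \<Rightarrow>\<^sub>0 nat) \<Rightarrow>\<^sub>0 'k) module"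
  where "veronese_algebra r d =
    \<lparr>carrier = generate_ring ring_of_type_algebra (range (Poly_Mapping.single 0) \<union> veronese_monomials r d),
     monoid.mult = (*), one = 1, ring.zero = 0, add = (+),
     module.smult = (\<lambda>c p. Poly_Mapping.single 0 c * p)\<rparr>"


section \<open>Basic well-formedness facts\<close>

lemma (in cring) free_module_is_module: "module R (free_module R I)"
proof -
  let ?F = "free_module R I"
  have F: "f \<in> carrier ?F \<longleftrightarrow>
      (\<forall>i. f i \<in> carrier R) \<and> (\<forall>i. i \<notin> I \<longrightarrow> f i = \<zero>) \<and> finite {i. f i \<noteq> \<zero>}" for f
    unfolding free_module_def by (simp, metis zero_closed)
  have sel: "add ?F = (\<lambda>f g i. f i \<oplus> g i)" "ring.zero ?F = (\<lambda>i. \<zero>)"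
      "module.smult ?F = (\<lambda>a f i. a \<otimes> f i)"
    by (simp_all add: free_module_def)
  have add: "(\<lambda>i. f i \<oplus> g i) \<in> carrier ?F" if "f \<in> carrier ?F" "g \<in> carrier ?F" for f g
  proof -
    have "{i. f i \<oplus> g i \<noteq> \<zero>} \<subseteq> {i. f i \<noteq> \<zero>} \<union> {i. g i \<noteq> \<zero>}" by auto
    moreover have "finite ({i. f i \<noteq> \<zero>} \<union> {i. g i \<noteq> \<zero>})" using that by (simp add: F)
    ultimately have "finite {i. f i \<oplus> g i \<noteq> \<zero>}" by (rule finite_subset)
    with that show ?thesis by (simp add: F)
  qed
  have smult: "(\<lambda>i. a \<otimes> f i) \<in> carrier ?F" if "a \<in> carrier R" "f \<in> carrier ?F" for a f
  proof -
    have "{i. a \<otimes> f i \<noteq> \<zero>} \<subseteq> {i. f i \<noteq> \<zero>}" using that(1) by auto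
    moreover have "finite {i. f i \<noteq> \<zero>}" using that by (simp add: F)
    ultimately have "finite {i. a \<otimes> f i \<noteq> \<zero>}" by (rule finite_subset)
    with that show ?thesis by (simp add: F)
  qed
  have inv: "\<exists>g\<in>carrier ?F. (\<lambda>i. g i \<oplus> f i) = (\<lambda>i. \<zero>)" if "f \<in> carrier ?F" for f
  proof (rule bexI)
    show "(\<lambda>i. (\<ominus> \<one>) \<otimes> f i) \<in> carrier ?F" using that by (intro smult) simp_all
    show "(\<lambda>i. (\<ominus> \<one>) \<otimes> f i \<oplus> f i) = (\<lambda>i. \<zero>)" using that by (simp add: F l_minus l_neg)
  qed
  have ab: "abelian_group ?F"
    by (rule abelian_groupI; simp only: sel) (simp_all add: add inv, simp_all add: F a_ac)
  show ?thesis
    by (rule moduleI[OF is_cring ab]; simp only: sel)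
       (simp_all add: smult, simp_all add: F l_distr r_distr m_assoc)
qed

context module begin

lemma submodule_abelian_subgroup:
  assumes "submodule N R M"
  shows "abelian_subgroup N M"
proof (rule abelian_subgroupI3)
  show "additive_subgroup N M"
    using submodule.axioms(1)[OF assms] by (rule additive_subgroup.intro)
  show "abelian_group M" by (rule abelian_group_axioms)
qed

lemma quotient_smult:
  assumes N: "submodule N R M" and a: "a \<in> carrier R" and x: "x \<in> carrier M"
  shows "a \<odot>\<^bsub>quotient_module M N\<^esub> (N +>\<^bsub>M\<^esub> x) = N +>\<^bsub>M\<^esub> (a \<odot>\<^bsub>M\<^esub> x)"
proof -
  interpret ag: abelian_subgroup N M by (rule submodule_abelian_subgroup[OF N])
  have *: "N +>\<^bsub>M\<^esub> (a \<odot>\<^bsub>M\<^esub> y) = N +>\<^bsub>M\<^esub> (a \<odot>\<^bsub>M\<^esub> x)" if "y \<in> N +>\<^bsub>M\<^esub> x" for y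
  proof -
    from that obtain n where n: "n \<in> N" "y = n \<oplus>\<^bsub>M\<^esub> x" unfolding a_r_coset_def' by blast
    then have "a \<odot>\<^bsub>M\<^esub> y = a \<odot>\<^bsub>M\<^esub> n \<oplus>\<^bsub>M\<^esub> a \<odot>\<^bsub>M\<^esub> x"
      using smult_r_distr[OF a ag.a_Hcarr[OF n(1)] x] by simp
    then have "a \<odot>\<^bsub>M\<^esub> y \<in> N +>\<^bsub>M\<^esub> (a \<odot>\<^bsub>M\<^esub> x)"
      using submoduleE(4)[OF N a n(1)] unfolding a_r_coset_def' by blast
    from ag.a_repr_independence'[OF this smult_closed[OF a x]] show ?thesis by (rule sym)
  qed
  have "a \<odot>\<^bsub>quotient_module M N\<^esub> (N +>\<^bsub>M\<^esub> x) = (\<Union>y\<in>N +>\<^bsub>M\<^esub> x. N +>\<^bsub>M\<^esub> (a \<odot>\<^bsub>M\<^esub> y))"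
    unfolding quotient_module_def by simp
  also have "\<dots> = (\<Union>y\<in>N +>\<^bsub>M\<^esub> x. N +>\<^bsub>M\<^esub> (a \<odot>\<^bsub>M\<^esub> x))"
    by (rule SUP_cong[OF refl *])
  also have "\<dots> = N +>\<^bsub>M\<^esub> (a \<odot>\<^bsub>M\<^esub> x)"
    by (rule UN_constant_eq[OF ag.a_rcos_self[OF x]]) (intro ballI refl)
  finally show ?thesis .
qed

lemma quotient_module_is_module:
  assumes N: "submodule N R M"
  shows "module R (quotient_module M N)"
proof -
  let ?Q = "quotient_module M N"
  interpret ag: abelian_subgroup N M by (rule submodule_abelian_subgroup[OF N])
  have car: "carrier ?Q = (\<lambda>x. N +>\<^bsub>M\<^esub> x) ` carrier M"
    unfolding quotient_module_def A_RCOSETS_def' partial_object.select_convs by blast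
  have add: "(N +>\<^bsub>M\<^esub> x) \<oplus>\<^bsub>?Q\<^esub> (N +>\<^bsub>M\<^esub> y) = N +>\<^bsub>M\<^esub> (x \<oplus>\<^bsub>M\<^esub> y)"
    if "x \<in> carrier M" "y \<in> carrier M" for x y
    using ag.a_rcos_sum[OF that] unfolding quotient_module_def by simp
  have zero: "\<zero>\<^bsub>?Q\<^esub> = N +>\<^bsub>M\<^esub> \<zero>\<^bsub>M\<^esub>"
    using M.a_coset_add_zero[OF ag.a_subset] unfolding quotient_module_def by simp
  show ?thesis
  proof (rule moduleI)
    show "abelian_group ?Q"
    proof (rule abelian_groupI; (unfold car)?; (elim imageE)?; (hypsubst)?)
      fix x assume x: "x \<in> carrier M"
      show "\<exists>y\<in>(+>\<^bsub>M\<^esub>) N ` carrier M. y \<oplus>\<^bsub>?Q\<^esub> (N +>\<^bsub>M\<^esub> x) = \<zero>\<^bsub>?Q\<^esub>"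
      proof (intro bexI imageI)
        show "(N +>\<^bsub>M\<^esub> (\<ominus>\<^bsub>M\<^esub> x)) \<oplus>\<^bsub>?Q\<^esub> (N +>\<^bsub>M\<^esub> x) = \<zero>\<^bsub>?Q\<^esub>"
          using x by (simp add: add zero M.l_neg)
      qed (use x in simp)
    qed (simp_all add: add zero M.a_ac)
  next
    show "cring R" by (rule R.is_cring)
  next
    fix a x assume "a \<in> carrier R" "x \<in> carrier ?Q"
    then show "a \<odot>\<^bsub>?Q\<^esub> x \<in> carrier ?Q"
      unfolding car by (elim imageE) (simp add: quotient_smult[OF N])
  next
    fix a b x assume "a \<in> carrier R" "b \<in> carrier R" "x \<in> carrier ?Q"
    then show "(a \<oplus> b) \<odot>\<^bsub>?Q\<^esub> x = a \<odot>\<^bsub>?Q\<^esub> x \<oplus>\<^bsub>?Q\<^esub> b \<odot>\<^bsub>?Q\<^esub> x"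
      unfolding car by (elim imageE) (simp add: add quotient_smult[OF N] smult_l_distr)
  next
    fix a x y assume "a \<in> carrier R" "x \<in> carrier ?Q" "y \<in> carrier ?Q"
    then show "a \<odot>\<^bsub>?Q\<^esub> (x \<oplus>\<^bsub>?Q\<^esub> y) = a \<odot>\<^bsub>?Q\<^esub> x \<oplus>\<^bsub>?Q\<^esub> a \<odot>\<^bsub>?Q\<^esub> y"
      unfolding car by (elim imageE) (simp add: add quotient_smult[OF N] smult_r_distr)
  next
    fix a b x assume "a \<in> carrier R" "b \<in> carrier R" "x \<in> carrier ?Q"
    then show "(a \<otimes> b) \<odot>\<^bsub>?Q\<^esub> x = a \<odot>\<^bsub>?Q\<^esub> (b \<odot>\<^bsub>?Q\<^esub> x)"
      unfolding car by (elim imageE) (simp add: add quotient_smult[OF N] smult_assoc1)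
  next
    fix x assume "x \<in> carrier ?Q"
    then show "\<one> \<odot>\<^bsub>?Q\<^esub> x = x"
      unfolding car by (elim imageE) (simp add: quotient_smult[OF N])
  qed
qed

lemma submodule_generated_is_submodule:
  assumes "G \<subseteq> carrier M"
  shows "submodule (submodule_generated R M G) R M"
proof (rule submoduleI)
  have c: "submodule (carrier M) R M" by (rule carrier_is_submodule)
  show "submodule_generated R M G \<subseteq> carrier M"
    using c assms by (auto simp: submodule_generated_def hull_def)
  show "\<zero>\<^bsub>M\<^esub> \<in> submodule_generated R M G"
    by (auto simp: submodule_generated_def hull_def dest!: submodule.axioms(1) dest: subgroup.one_closed)
next
  fix a assume "a \<in> submodule_generated R M G"
  then show "\<ominus>\<^bsub>M\<^esub> a \<in> submodule_generated R M G"
    by (simp add: submodule_generated_def hull_def submoduleE(3))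
next
  fix a b assume "a \<in> submodule_generated R M G" "b \<in> submodule_generated R M G"
  then show "a \<oplus>\<^bsub>M\<^esub> b \<in> submodule_generated R M G"
    by (simp add: submodule_generated_def hull_def submoduleE(5))
next
  fix a x assume "a \<in> carrier R" "x \<in> submodule_generated R M G"
  then show "a \<odot>\<^bsub>M\<^esub> x \<in> submodule_generated R M G"
    by (simp add: submodule_generated_def hull_def submoduleE(4))
qed

end

lemma kaehler_differentials_is_module:
  assumes "algebra K A"
  shows "module A (kaehler_differentials K A)"
proof -
  interpret A: cring A by (rule algebra.M_cring[OF assms])
  let ?F = "free_module A (carrier A)"
  interpret F: module A ?F by (rule A.free_module_is_module)
  have d: "free_basis A x \<in> carrier ?F" if "x \<in> carrier A" for x
    using that by (auto simp: free_module_def free_basis_def)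
  have c: "c \<odot>\<^bsub>A\<^esub> x \<in> carrier A" if "c \<in> carrier K" "x \<in> carrier A" for c x
    using module.smult_closed[OF algebra.module[OF assms]] that .
  have "kaehler_relations K A \<subseteq> carrier ?F"
    unfolding kaehler_relations_def Let_def
    by (intro Un_least subsetI; elim CollectE exE conjE; hypsubst;
        intro F.minus_closed F.M.a_closed F.smult_closed d A.a_closed A.m_closed c
          A.one_closed; assumption)
  then show ?thesis
    unfolding kaehler_differentials_def Let_def
    by (intro F.quotient_module_is_module F.submodule_generated_is_submodule)
qed

lemma veronese_is_algebra:
  "algebra (ring_of_type_algebra :: 'k::field ring) (veronese_algebra r d)"
proof -
  let ?P = "ring_of_type_algebra :: ((nat \<Rightarrow>\<^sub>0 nat) \<Rightarrow>\<^sub>0 'k) ring"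
  let ?V = "veronese_algebra r d :: ('k, _) module"
  interpret P: cring ?P by (rule cring_from_type_algebra)
  have "subring (carrier ?V) ?P"
    unfolding veronese_algebra_def partial_object.select_convs
    by (rule P.generate_ring_is_subring) (simp add: ring_of_type_algebra_def)
  then have "subcring (carrier ?V) ?P" by (rule P.subcringI')
  then have "cring (?P\<lparr>carrier := carrier ?V\<rparr>)"
    by (subst (asm) P.subcring_iff) (simp_all add: ring_of_type_algebra_def)
  then interpret V: cring "?P\<lparr>carrier := carrier ?V\<rparr>" .
  have single: "Poly_Mapping.single 0 c \<in> carrier ?V" for c
    by (auto simp: veronese_algebra_def intro: generate_ring.incl)
  have ex: "\<exists>y\<in>carrier ?V. y + x = 0" if "x \<in> carrier ?V" for x
    using V.add.l_inv_ex[of x] that by (simp add: ring_of_type_algebra_def)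
  have cl: "x + y \<in> carrier ?V" "x * y \<in> carrier ?V" if "x \<in> carrier ?V" "y \<in> carrier ?V" for x y
    using V.a_closed[of x y] V.m_closed[of x y] that by (simp_all add: ring_of_type_algebra_def)
  have 01: "0 \<in> carrier ?V" "1 \<in> carrier ?V"
    using V.zero_closed V.one_closed by (simp_all add: ring_of_type_algebra_def)
  have sel: "monoid.mult ?V = (*)" "one ?V = 1" "ring.zero ?V = 0" "add ?V = (+)" "module.smult ?V = (\<lambda>c p. Poly_Mapping.single 0 c * p)"
    by (simp_all add: veronese_algebra_def)
  have cr: "cring ?V"
  proof (rule cringI)
    show "abelian_group ?V"
      by (rule abelian_groupI; simp only: sel cl 01 ex add.assoc add_0) (rule add.commute)
    show "Group.comm_monoid ?V"
      by (rule comm_monoidI) (simp_all add: sel cl 01 mult_ac)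
  qed (simp add: sel distrib_right)
  have k: "carrier (ring_of_type_algebra :: 'k ring) = UNIV" "monoid.mult (ring_of_type_algebra :: 'k ring) = (*)"
    "add (ring_of_type_algebra :: 'k ring) = (+)" "one (ring_of_type_algebra :: 'k ring) = 1"
    by (simp_all add: ring_of_type_algebra_def)
  have mm: "Poly_Mapping.single 0 (a * b) = Poly_Mapping.single 0 a * (Poly_Mapping.single 0 b :: (nat \<Rightarrow>\<^sub>0 nat) \<Rightarrow>\<^sub>0 'k)" for a b
    by (simp add: mult_single)
  show ?thesis
    by (rule algebraI[OF cring_from_type_algebra cr];
        simp only: sel k mm single_add single_one mult.assoc distrib_left distrib_right mult_1 cl single)
qed

end

theory Submission
  imports Defs "HOL-Library.Function_Algebras"
begin

text \<open>
  Torsion of \<open>\<Omega>\<close> is detected by derivations: a differential \<open>\<Sum> f dg\<close> is torsion iff \<open>\<Sum> f \<delta>(g) = 0\<close>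
  for all derivations \<open>\<delta>\<close> of the coordinate ring.

  For \<open>d \<ge> 3\<close> let \<open>a, b, c, e\<close> be \<open>x\<^sup>d\<close>, \<open>x\<^sup>d\<^sup>-\<^sup>1y\<close>, \<open>x\<^sup>d\<^sup>-\<^sup>2y\<^sup>2\<close>, \<open>x\<^sup>d\<^sup>-\<^sup>3y\<^sup>3\<close>. The relations \<open>ac = b\<^sup>2\<close> and
  \<open>ae = bc\<close> force every derivation to kill \<open>a de - e da - 3 (b dc - c db)\<close>. This differential is not
  zero: writing \<open>f\<^sub>s\<close> for the coefficient of the monomial \<open>s\<close> in \<open>f\<close>, the assignment
  \<open>f dg \<mapsto> f\<^sub>a g\<^sub>e - f\<^sub>e g\<^sub>a\<close> respects the Leibniz rule, since \<open>a\<close> and \<open>e\<close> are not products of two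
  non-constant monomials of the algebra, and it maps the differential to \<open>2\<close>.

  For \<open>d \<le> 2\<close> it is enough to consider the derivations \<open>x\<^sub>l \<partial>/\<partial>x\<^sub>l\<close>. They compute the image of a
  differential in the module of differentials of the polynomial ring, and this image determines the
  differential, because there are elements \<open>T l \<mu>\<close> of \<open>\<Omega>\<close> playing the role of \<open>x\<^sup>\<mu> dx\<^sub>l / x\<^sub>l\<close>.
  For \<open>d = 2\<close> these are given by a polarisation formula,
  \<open>2 x\<^sub>a x\<^sub>b x\<^sub>c dx\<^sub>i = x\<^sub>b x\<^sub>c d(x\<^sub>a x\<^sub>i) + x\<^sub>a x\<^sub>c d(x\<^sub>b x\<^sub>i) - x\<^sub>c x\<^sub>i d(x\<^sub>a x\<^sub>b)\<close>.
\<close>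

section \<open>Differentials of an algebra over a type class ring\<close>

definition scl :: "'s::comm_ring_1 \<Rightarrow> ('s \<Rightarrow> 's) \<Rightarrow> 's \<Rightarrow> 's" (infixr \<open>*\<^sub>F\<close> 75)
  where "a *\<^sub>F w = (\<lambda>i. a * w i)"

definition dd :: "'s::comm_ring_1 \<Rightarrow> 's \<Rightarrow> 's"
  where "dd x = (\<lambda>j. if j = x then 1 else 0)"

lemma scl_apply [simp]: "(a *\<^sub>F w) i = a * w i"
  by (simp add: scl_def)

lemma sum_fun_apply: "(\<Sum>i\<in>I. f i) x = (\<Sum>i\<in>I. f i x)"
  by (induction I rule: infinite_finite_induct) auto

text \<open>
  The operations of \<open>A\<close> are those of the type, so that elements of the free module on \<open>A\<close> are added
  and multiplied pointwise, and congruences of differentials become memberships \<open>u - w \<in> N\<close>.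
\<close>

locale concrete_algebra =
  fixes A :: "('k::field, 's::comm_ring_1) module"
  assumes algebra: "algebra (ring_of_type_algebra :: 'k ring) A"
    and ops: "monoid.mult A = (*)" "one A = 1" "ring.zero A = 0" "add A = (+)"
begin

section \<open>Finitely supported sums of differentials and the submodule of relations\<close>

definition F :: "('s \<Rightarrow> 's) set" where "F = carrier (free_module A (carrier A))"

definition N :: "('s \<Rightarrow> 's) set" where
  "N = submodule_generated A (free_module A (carrier A)) (kaehler_relations (ring_of_type_algebra :: 'k ring) A)"

sublocale A: cring A
  by (rule algebra.M_cring[OF algebra])

sublocale FM: module A "free_module A (carrier A)"
  by (rule A.free_module_is_module)

lemma carrier_0 [simp]: "0 \<in> carrier A"
  using A.zero_closed by (simp add: ops)

lemma carrier_1 [simp]: "1 \<in> carrier A"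
  using A.one_closed by (simp add: ops)
lemma carrier_add: "x \<in> carrier A \<Longrightarrow> y \<in> carrier A \<Longrightarrow> x + y \<in> carrier A"
  using A.a_closed[of x y] by (simp add: ops)
lemma carrier_mult: "x \<in> carrier A \<Longrightarrow> y \<in> carrier A \<Longrightarrow> x * y \<in> carrier A"
  using A.m_closed[of x y] by (simp add: ops)
lemma carrier_uminus: "x \<in> carrier A \<Longrightarrow> - x \<in> carrier A"
  using A.a_inv_closed[of x] A.l_neg[of x] by (metis eq_neg_iff_add_eq_0 minus_equation_iff ops(3,4))

lemma carrier_sum: "(\<And>i. i \<in> I \<Longrightarrow> f i \<in> carrier A) \<Longrightarrow> sum f I \<in> carrier A"
  by (induction I rule: infinite_finite_induct) (auto intro: carrier_add)

lemma mem_F: "w \<in> F \<longleftrightarrow> (\<forall>i. w i \<in> carrier A) \<and> (\<forall>i. i \<notin> carrier A \<longrightarrow> w i = 0) \<and> finite {i. w i \<noteq> 0}"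
proof -
  have "F = {f. (\<forall>i\<in>carrier A. f i \<in> carrier A) \<and> (\<forall>i. i \<notin> carrier A \<longrightarrow> f i = 0) \<and> finite {i. f i \<noteq> 0}}"
    by (simp add: F_def free_module_def ops)
  moreover have "w i \<in> carrier A" if "\<forall>i\<in>carrier A. w i \<in> carrier A" "\<forall>i. i \<notin> carrier A \<longrightarrow> w i = 0" for i
    using that by (cases "i \<in> carrier A") auto
  ultimately show ?thesis by auto
qed

lemma free_sel: "add (free_module A (carrier A)) = (+)" "ring.zero (free_module A (carrier A)) = 0"
   "module.smult (free_module A (carrier A)) = (*\<^sub>F)" "free_basis A x = dd x"
  by (auto simp: free_module_def free_basis_def ops fun_eq_iff dd_def)

lemma F_dd [simp]: "x \<in> carrier A \<Longrightarrow> dd x \<in> F"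
  by (auto simp: mem_F dd_def)

lemma F_0 [simp]: "0 \<in> F" by (simp add: mem_F)
lemma F_add: "u \<in> F \<Longrightarrow> w \<in> F \<Longrightarrow> u + w \<in> F"
  using FM.M.a_closed[of u w] by (simp add: free_sel F_def)
lemma F_scl: "a \<in> carrier A \<Longrightarrow> w \<in> F \<Longrightarrow> a *\<^sub>F w \<in> F"
  using FM.smult_closed[of a w] by (simp add: free_sel F_def)
lemma free_a_inv: "w \<in> F \<Longrightarrow> \<ominus>\<^bsub>free_module A (carrier A)\<^esub> w = - w"
  using FM.M.l_neg[of w] by (simp add: free_sel F_def eq_neg_iff_add_eq_0)
lemma F_uminus: "w \<in> F \<Longrightarrow> - w \<in> F"
  using FM.M.a_inv_closed[of w] free_a_inv[of w] by (simp add: F_def)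
lemma F_diff: "u \<in> F \<Longrightarrow> w \<in> F \<Longrightarrow> u - w \<in> F"
  using F_add[of u "-w"] F_uminus by simp

lemma kaehler_relations_eq: "kaehler_relations (ring_of_type_algebra :: 'k ring) A =
    {dd (x + y) - (dd x + dd y) | x y. x \<in> carrier A \<and> y \<in> carrier A} \<union>
    {dd (x * y) - (x *\<^sub>F dd y + y *\<^sub>F dd x) | x y. x \<in> carrier A \<and> y \<in> carrier A} \<union>
    range (\<lambda>c. dd (c \<odot>\<^bsub>A\<^esub> 1))"
proof -
  have "u \<ominus>\<^bsub>free_module A (carrier A)\<^esub> w = u - w" if "w \<in> F" for u w
    using that by (simp add: a_minus_def free_a_inv free_sel)
  then have 1: "dd (x + y) \<ominus>\<^bsub>free_module A (carrier A)\<^esub> (dd x + dd y) = dd (x + y) - (dd x + dd y)"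
     "dd (x * y) \<ominus>\<^bsub>free_module A (carrier A)\<^esub> (x *\<^sub>F dd y + y *\<^sub>F dd x) = dd (x * y) - (x *\<^sub>F dd y + y *\<^sub>F dd x)"
    if "x \<in> carrier A" "y \<in> carrier A" for x y
    by (simp_all add: that F_add F_scl)
  have K: "carrier (ring_of_type_algebra :: 'k ring) = UNIV" by (simp add: ring_of_type_algebra_def)
  show ?thesis
    unfolding kaehler_relations_def Let_def free_sel ops K
    by (intro arg_cong2[where f="(\<union>)"] Collect_cong ex_cong1) (auto simp: 1)
qed

lemma const_carrier: "c \<odot>\<^bsub>A\<^esub> 1 \<in> carrier A"
  using module.smult_closed[OF algebra.module[OF algebra], of c "\<one>\<^bsub>A\<^esub>"]
  by (simp add: ops ring_of_type_algebra_def)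

lemma kaehler_relations_F: "kaehler_relations (ring_of_type_algebra :: 'k ring) A \<subseteq> F"
  by (auto simp: kaehler_relations_eq const_carrier intro!: F_diff F_add F_scl F_dd carrier_add carrier_mult)

lemma submodule_N: "submodule N A (free_module A (carrier A))"
  unfolding N_def using kaehler_relations_F
  by (intro FM.submodule_generated_is_submodule) (simp add: F_def)

lemma N_F: "w \<in> N \<Longrightarrow> w \<in> F"
  using FM.submoduleE(1)[OF submodule_N] by (auto simp: F_def)
lemma N_add: "u \<in> N \<Longrightarrow> w \<in> N \<Longrightarrow> u + w \<in> N"
  using FM.submoduleE(5)[OF submodule_N, of u w] by (simp add: free_sel)
lemma N_scl: "a \<in> carrier A \<Longrightarrow> w \<in> N \<Longrightarrow> a *\<^sub>F w \<in> N"
  using FM.submoduleE(4)[OF submodule_N, of a w] by (simp add: free_sel)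
lemma N_uminus: "w \<in> N \<Longrightarrow> - w \<in> N"
  using FM.submoduleE(3)[OF submodule_N, of w] free_a_inv[OF N_F, of w] by simp
lemma N_diff: "u \<in> N \<Longrightarrow> w \<in> N \<Longrightarrow> u - w \<in> N"
  using N_add[of u "-w"] N_uminus by simp
lemma N_0 [simp]: "0 \<in> N"
  using subgroup.one_closed[OF submodule.axioms(1)[OF submodule_N]] by (simp add: free_sel)
lemma N_sum: "(\<And>i. i \<in> I \<Longrightarrow> f i \<in> N) \<Longrightarrow> sum f I \<in> N"
  by (induction I rule: infinite_finite_induct) (auto intro: N_add)

lemma N_incl: "w \<in> kaehler_relations (ring_of_type_algebra :: 'k ring) A \<Longrightarrow> w \<in> N"
  unfolding N_def submodule_generated_def by (rule hull_inc)

lemma N_dd_add: "x \<in> carrier A \<Longrightarrow> y \<in> carrier A \<Longrightarrow> dd (x + y) - (dd x + dd y) \<in> N"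
  by (rule N_incl) (auto simp: kaehler_relations_eq)
lemma N_dd_mult: "x \<in> carrier A \<Longrightarrow> y \<in> carrier A \<Longrightarrow> dd (x * y) - (x *\<^sub>F dd y + y *\<^sub>F dd x) \<in> N"
  by (rule N_incl) (auto simp: kaehler_relations_eq)
lemma N_dd_const: "dd (c \<odot>\<^bsub>A\<^esub> 1) \<in> N"
  by (rule N_incl) (auto simp: kaehler_relations_eq)

lemma N_minimal:
  assumes "kaehler_relations (ring_of_type_algebra :: 'k ring) A \<subseteq> M" "M \<subseteq> F" "0 \<in> M"
    "\<And>u w. u \<in> M \<Longrightarrow> w \<in> M \<Longrightarrow> u + w \<in> M" 
    "\<And>a w. a \<in> carrier A \<Longrightarrow> w \<in> M \<Longrightarrow> a *\<^sub>F w \<in> M"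
  shows "N \<subseteq> M"
proof -
  have "- w \<in> M" if "w \<in> M" for w
  proof -
    have "-1 *\<^sub>F w \<in> M" using that by (intro assms(5) carrier_uminus) auto
    then show ?thesis by (simp add: scl_def fun_Compl_def)
  qed
  then have "submodule M A (free_module A (carrier A))"
    using assms(2-5) free_a_inv
    by (intro FM.submoduleI) (auto simp: free_sel F_def)
  then show ?thesis
    unfolding N_def submodule_generated_def by (intro hull_minimal assms(1))
qed


text \<open>The additive map with \<open>f dg \<mapsto> \<psi> f g\<close>. The codomain is just an
  abelian group, because the map that detects the torsion element takes values in the ground field
  and is not linear over \<open>A\<close>.\<close>

definition ev :: "('s \<Rightarrow> 's \<Rightarrow> 'b::ab_group_add) \<Rightarrow> ('s \<Rightarrow> 's) \<Rightarrow> 'b"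
  where "ev \<psi> w = (\<Sum>g | w g \<noteq> 0. \<psi> (w g) g)"

context
  fixes \<psi> :: "'s \<Rightarrow> 's \<Rightarrow> 'b::ab_group_add"
  assumes psi_add: "\<And>a b g. \<psi> (a + b) g = \<psi> a g + \<psi> b g"
begin

lemma psi_0: "\<psi> 0 g = 0"
  using psi_add[of 0 0 g] by simp

lemma ev_superset: "finite T \<Longrightarrow> {g. w g \<noteq> 0} \<subseteq> T \<Longrightarrow> ev \<psi> w = (\<Sum>g\<in>T. \<psi> (w g) g)"
  unfolding ev_def by (rule sum.mono_neutral_left) (auto simp: psi_0)

lemma ev_add: "u \<in> F \<Longrightarrow> w \<in> F \<Longrightarrow> ev \<psi> (u + w) = ev \<psi> u + ev \<psi> w"
proof -
  assume "u \<in> F" "w \<in> F"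
  then have fin: "finite ({g. u g \<noteq> 0} \<union> {g. w g \<noteq> 0})" (is "finite ?T") by (auto simp: mem_F)
  have "ev \<psi> u = (\<Sum>g\<in>?T. \<psi> (u g) g)" "ev \<psi> w = (\<Sum>g\<in>?T. \<psi> (w g) g)"
    "ev \<psi> (u + w) = (\<Sum>g\<in>?T. \<psi> ((u + w) g) g)"
    by (rule ev_superset[OF fin], force)+
  then show ?thesis by (simp add: psi_add sum.distrib)
qed

lemma ev_diff: "u \<in> F \<Longrightarrow> w \<in> F \<Longrightarrow> ev \<psi> (u - w) = ev \<psi> u - ev \<psi> w"
  using ev_add[of "u - w" w] F_diff[of u w] by simp

lemma ev_dd: "ev \<psi> (a *\<^sub>F dd x) = \<psi> a x"
proof -
  have "ev \<psi> (a *\<^sub>F dd x) = (\<Sum>g\<in>{x}. \<psi> ((a *\<^sub>F dd x) g) g)"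
    by (rule ev_superset) (auto simp: dd_def)
  then show ?thesis by (simp add: dd_def)
qed

lemma ev_vanishes_on_N:
  assumes "\<And>a x y. a \<in> carrier A \<Longrightarrow> x \<in> carrier A \<Longrightarrow> y \<in> carrier A \<Longrightarrow> \<psi> a (x + y) = \<psi> a x + \<psi> a y"
    and "\<And>a x y. a \<in> carrier A \<Longrightarrow> x \<in> carrier A \<Longrightarrow> y \<in> carrier A \<Longrightarrow> \<psi> a (x * y) = \<psi> (a * x) y + \<psi> (a * y) x"
    and "\<And>a c. a \<in> carrier A \<Longrightarrow> \<psi> a (c \<odot>\<^bsub>A\<^esub> 1) = 0"
    and "w \<in> N"
  shows "ev \<psi> w = 0"
proof -
  \<comment> \<open>Since \<open>ev \<psi>\<close> is only additive, its kernel need not be a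
    submodule. Requiring that all multiples of \<open>w\<close> are killed as well makes
    \<open>M\<close> one; \<open>a = 1\<close> gives the claim back.\<close>
  define M where "M = {w \<in> F. \<forall>a\<in>carrier A. ev \<psi> (a *\<^sub>F w) = 0}"
  have scl: "a *\<^sub>F (u + v) = a *\<^sub>F u + a *\<^sub>F v" "a *\<^sub>F (u - v) = a *\<^sub>F u - a *\<^sub>F v"
    "a *\<^sub>F b *\<^sub>F u = (a * b) *\<^sub>F u" for a b :: 's and u v
    by (auto simp: fun_eq_iff algebra_simps)
  note F = F_dd F_scl F_add carrier_add carrier_mult const_carrier
  have "N \<subseteq> M"
  proof (rule N_minimal)
    show "kaehler_relations (ring_of_type_algebra :: 'k ring) A \<subseteq> M"
      unfolding kaehler_relations_eq M_def
      by (auto simp: F F_diff scl ev_diff ev_add ev_dd assms(1-3))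
    have "a *\<^sub>F 0 = 0" for a :: 's by (simp add: fun_eq_iff)
    then show "0 \<in> M" by (simp add: M_def ev_def)
  qed (auto simp: M_def F scl ev_add)
  with \<open>w \<in> N\<close> have "ev \<psi> (1 *\<^sub>F w) = 0" unfolding M_def using carrier_1 by blast
  then show ?thesis by (simp add: scl_def)
qed

end

section \<open>Torsion in terms of linear forms that kill the relations\<close>

definition linear_form :: "(('s \<Rightarrow> 's) \<Rightarrow> 's) \<Rightarrow> bool" where
  "linear_form g \<longleftrightarrow> (\<forall>x\<in>F. g x \<in> carrier A) \<and> (\<forall>x\<in>F. \<forall>y\<in>F. g (x + y) = g x + g y) \<and>
     (\<forall>a\<in>carrier A. \<forall>x\<in>F. g (a *\<^sub>F x) = a * g x) \<and> (\<forall>x\<in>N. g x = 0)"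

definition cls :: "('s \<Rightarrow> 's) \<Rightarrow> ('s \<Rightarrow> 's) set" where
  "cls x = N +>\<^bsub>free_module A (carrier A)\<^esub> x"

lemma cls_eq: "cls x = (\<lambda>n. n + x) ` N"
  by (auto simp: cls_def a_r_coset_def' free_sel)

lemma cls_eq_iff: "cls x = cls y \<longleftrightarrow> x - y \<in> N"
proof
  assume "cls x = cls y"
  moreover have "x \<in> cls x" by (auto simp: cls_eq intro!: image_eqI[of _ _ 0])
  ultimately show "x - y \<in> N" by (auto simp: cls_eq)
next
  assume *: "x - y \<in> N"
  then have **: "y - x \<in> N" using N_uminus[OF *] by simp
  have "n + x \<in> cls y" "n + y \<in> cls x" if "n \<in> N" for n
    unfolding cls_eq
    by (rule image_eqI[of _ _ "n + (x - y)"], simp, rule N_add[OF that *])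
       (rule image_eqI[of _ _ "n + (y - x)"], simp, rule N_add[OF that **])
  then show "cls x = cls y" by (auto simp: cls_eq)
qed

lemma cls_0: "cls 0 = N" by (simp add: cls_eq)

abbreviation "\<Omega> \<equiv> kaehler_differentials (ring_of_type_algebra :: 'k ring) A"

lemma Omega_eq: "\<Omega> = quotient_module (free_module A (carrier A)) N"
  by (simp add: kaehler_differentials_def N_def Let_def)

lemma carrier_Omega: "carrier \<Omega> = cls ` F"
  unfolding Omega_eq quotient_module_def A_RCOSETS_def' partial_object.select_convs cls_def F_def by blast

lemma zero_Omega: "\<zero>\<^bsub>\<Omega>\<^esub> = N"
  by (simp add: Omega_eq quotient_module_def)

lemma add_Omega: "x \<in> F \<Longrightarrow> y \<in> F \<Longrightarrow> cls x \<oplus>\<^bsub>\<Omega>\<^esub> cls y = cls (x + y)"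
proof -
  assume *: "x \<in> F" "y \<in> F"
  interpret ag: abelian_subgroup N "free_module A (carrier A)"
    by (rule FM.submodule_abelian_subgroup[OF submodule_N])
  from * show ?thesis
    using ag.a_rcos_sum[of x y] by (simp add: Omega_eq quotient_module_def cls_def F_def free_sel)
qed

lemma smult_Omega: "a \<in> carrier A \<Longrightarrow> x \<in> F \<Longrightarrow> a \<odot>\<^bsub>\<Omega>\<^esub> cls x = cls (a *\<^sub>F x)"
  using FM.quotient_smult[OF submodule_N, of a x] by (simp add: Omega_eq cls_def F_def free_sel)

lemma has_torsion_iff_bidual:
  "has_torsion A \<Omega> \<longleftrightarrow> (\<exists>w\<in>F. w \<notin> N \<and> (\<forall>f\<in>carrier (dual_module A \<Omega>). f (cls w) = 0))"
proof -
  have ker: "cls w \<in> torsion_submodule A \<Omega> \<longleftrightarrow> (\<forall>f\<in>carrier (dual_module A \<Omega>). f (cls w) = 0)"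
    if "w \<in> F" for w
  proof -
    have z: "ring.zero (dual_module A M) = (\<lambda>x\<in>carrier M. 0)" for M :: "('s, 'x, 'y) module_scheme"
      by (simp add: dual_module_def ops)
    show ?thesis
      using that unfolding torsion_submodule_def a_kernel_def' bidual_map_def z
      by (auto simp: carrier_Omega fun_eq_iff restrict_def)
  qed
  have "torsion_submodule A \<Omega> \<subseteq> cls ` F"
    unfolding torsion_submodule_def a_kernel_def' carrier_Omega by blast
  \<comment> \<open>The zero class always lies in the kernel, so torsion means that some other class
    does.\<close>
  moreover have "N \<in> torsion_submodule A \<Omega>"
  proof -
    have "f N = 0" if f: "f \<in> carrier (dual_module A \<Omega>)" for f
    proof -
      have "f (cls 0 \<oplus>\<^bsub>\<Omega>\<^esub> cls 0) = f (cls 0) + f (cls 0)"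
        using f by (auto simp: dual_module_def ops carrier_Omega)
      then show ?thesis using add_Omega[of 0 0] by (simp add: cls_0)
    qed
    then show ?thesis using ker[of 0] by (simp add: cls_0)
  qed
  moreover have "cls w = N \<longleftrightarrow> w \<in> N" for w
    using cls_eq_iff[of w 0] by (simp add: cls_0)
  moreover from calculation(2) have "has_torsion A \<Omega> \<longleftrightarrow> (\<exists>C\<in>torsion_submodule A \<Omega>. C \<noteq> N)"
    unfolding has_torsion_def zero_Omega by blast
  moreover have "(\<exists>C\<in>T. C \<noteq> N) \<longleftrightarrow> (\<exists>w\<in>F. w \<notin> N \<and> cls w \<in> T)"
    if T: "T \<subseteq> cls ` F" and iff: "\<And>w. cls w = N \<longleftrightarrow> w \<in> N" for T
    unfolding iff[symmetric] using T by fast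
  ultimately have "has_torsion A \<Omega> \<longleftrightarrow> (\<exists>w\<in>F. w \<notin> N \<and> cls w \<in> torsion_submodule A \<Omega>)"
    by simp
  also have "\<dots> \<longleftrightarrow> (\<exists>w\<in>F. w \<notin> N \<and> (\<forall>f\<in>carrier (dual_module A \<Omega>). f (cls w) = 0))"
    by (intro bex_cong refl conj_cong ker)
  finally show ?thesis .
qed

text \<open>A linear form on \<open>\<Omega>\<close> pulls back along \<open>cls\<close>, and a form
  on the free module that kills \<open>N\<close> descends. From here on no cosets are
  needed.\<close>

lemma has_torsion_iff: "has_torsion A \<Omega> \<longleftrightarrow> (\<exists>w\<in>F. w \<notin> N \<and> (\<forall>g. linear_form g \<longrightarrow> g w = 0))"
proof -
  have "linear_form (f \<circ> cls)" if "f \<in> carrier (dual_module A \<Omega>)" for f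
  proof -
    have 1: "f (cls x) \<in> carrier A" if "x \<in> F" for x
      using \<open>f \<in> _\<close> that by (auto simp: dual_module_def carrier_Omega PiE_iff)
    have 2: "f (cls (x + y)) = f (cls x) + f (cls y)" if "x \<in> F" "y \<in> F" for x y
      using \<open>f \<in> _\<close> that by (auto simp: dual_module_def carrier_Omega ops add_Omega)
    have 3: "f (cls (a *\<^sub>F x)) = a * f (cls x)" if "a \<in> carrier A" "x \<in> F" for a x
      using \<open>f \<in> _\<close> that by (auto simp: dual_module_def carrier_Omega ops smult_Omega)
    have "f (cls x) = 0" if "x \<in> N" for x
      using that cls_eq_iff[of x 0] 2[of 0 0] by simp
    with 1 2 3 show ?thesis by (auto simp: linear_form_def)
  qed
  moreover have "\<exists>f\<in>carrier (dual_module A \<Omega>). \<forall>w\<in>F. f (cls w) = g w" if g: "linear_form g" for g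
  proof -
    \<comment> \<open>Evaluation at a chosen representative, which is independent of the choice
      because \<open>g\<close> kills \<open>N\<close>. The restriction to the carrier reflects that
      elements of the dual are extensional.\<close>
    define f where "f = (\<lambda>C\<in>carrier \<Omega>. g (SOME x. x \<in> F \<and> cls x = C))"
    have f: "f (cls w) = g w" if "w \<in> F" for w
    proof -
      define y where "y = (SOME y. y \<in> F \<and> cls y = cls w)"
      have "y \<in> F \<and> cls y = cls w" unfolding y_def by (rule someI[of _ w]) (simp add: that)
      then have y: "y \<in> F" "y - w \<in> N" by (auto simp: cls_eq_iff)
      have "g ((y - w) + w) = g (y - w) + g w"
        using g y(2) N_F that unfolding linear_form_def by blast
      then have "g y = g w" using g y(2) by (simp add: linear_form_def)
      then show ?thesis using that by (simp add: f_def carrier_Omega y_def)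
    qed
    have "f \<in> carrier \<Omega> \<rightarrow>\<^sub>E carrier A"
      using f g by (auto simp: PiE_iff carrier_Omega linear_form_def) (simp add: f_def carrier_Omega)
    moreover have "f (cls x \<oplus>\<^bsub>\<Omega>\<^esub> cls y) = f (cls x) + f (cls y)" if "x \<in> F" "y \<in> F" for x y
      using that g by (simp add: add_Omega f F_add linear_form_def)
    moreover have "f (a \<odot>\<^bsub>\<Omega>\<^esub> cls x) = a * f (cls x)" if "a \<in> carrier A" "x \<in> F" for a x
      using that g by (simp add: smult_Omega f F_scl linear_form_def)
    ultimately have "f \<in> carrier (dual_module A \<Omega>)"
      unfolding dual_module_def by (simp add: ops carrier_Omega)
    with f show ?thesis by blast
  qed
  ultimately have "(\<forall>f\<in>carrier (dual_module A \<Omega>). f (cls w) = 0) \<longleftrightarrow> (\<forall>g. linear_form g \<longrightarrow> g w = 0)"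
    if "w \<in> F" for w
    using that by fastforce
  then show ?thesis
    unfolding has_torsion_iff_bidual by (intro bex_cong refl conj_cong)
qed

end

section \<open>Veronese algebras\<close>

abbreviation unitv :: "nat \<Rightarrow> nat \<Rightarrow>\<^sub>0 nat" where "unitv i \<equiv> Poly_Mapping.single i 1"

abbreviation xmon :: "(nat \<Rightarrow>\<^sub>0 nat) \<Rightarrow> (nat \<Rightarrow>\<^sub>0 nat) \<Rightarrow>\<^sub>0 'k::field" where
  "xmon m \<equiv> Poly_Mapping.single m 1"

abbreviation const :: "'k::field \<Rightarrow> (nat \<Rightarrow>\<^sub>0 nat) \<Rightarrow>\<^sub>0 'k" where
  "const c \<equiv> Poly_Mapping.single 0 c"

lemma sum_monomials: "(\<Sum>m\<in>Poly_Mapping.keys p. Poly_Mapping.single m (Poly_Mapping.lookup p m)) = p"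
  by (rule poly_mapping_eqI) (simp add: lookup_sum lookup_single when_def in_keys_iff)

text \<open>Expand both arguments into monomials. Only exponents in the supports are compared, so
  membership of \<open>p\<close> and \<open>q\<close> in a graded subring can be exploited.\<close>

lemma biadditive_eqI:
  fixes B B' :: "('m \<Rightarrow>\<^sub>0 'k::ab_group_add) \<Rightarrow> ('m \<Rightarrow>\<^sub>0 'k) \<Rightarrow> 'b::ab_group_add"
  assumes "\<And>q. Modules.additive (\<lambda>p. B p q)" "\<And>p. Modules.additive (B p)"
    and "\<And>q. Modules.additive (\<lambda>p. B' p q)" "\<And>p. Modules.additive (B' p)"
    and eq: "\<And>m n a b. m \<in> Poly_Mapping.keys p \<Longrightarrow> n \<in> Poly_Mapping.keys q \<Longrightarrow>
      B (Poly_Mapping.single m a) (Poly_Mapping.single n b) = B' (Poly_Mapping.single m a) (Poly_Mapping.single n b)"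
  shows "B p q = B' p q"
proof -
  have *: "B p q = (\<Sum>m\<in>Poly_Mapping.keys p. \<Sum>n\<in>Poly_Mapping.keys q.
      B (Poly_Mapping.single m (Poly_Mapping.lookup p m)) (Poly_Mapping.single n (Poly_Mapping.lookup q n)))"
    if "\<And>q. Modules.additive (\<lambda>p. B p q)" "\<And>p. Modules.additive (B p)"
    for B :: "('m \<Rightarrow>\<^sub>0 'k) \<Rightarrow> ('m \<Rightarrow>\<^sub>0 'k) \<Rightarrow> 'b"
  proof -
    have "B p q = B (\<Sum>m\<in>Poly_Mapping.keys p. Poly_Mapping.single m (Poly_Mapping.lookup p m))
      (\<Sum>m\<in>Poly_Mapping.keys q. Poly_Mapping.single m (Poly_Mapping.lookup q m))"
      by (simp only: sum_monomials)
    then show ?thesis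
      unfolding additive.sum[OF that(1)] additive.sum[OF that(2)] by (subst sum.swap)
  qed
  show ?thesis
    unfolding *[OF assms(1,2)] *[OF assms(3,4)] by (intro sum.cong refl eq)
qed

section \<open>Degrees and factorisations of monomials\<close>

definition mdeg :: "nat \<Rightarrow> (nat \<Rightarrow>\<^sub>0 nat) \<Rightarrow> nat" where
  "mdeg r m = (\<Sum>i\<le>r. Poly_Mapping.lookup m i)"

lemma mdeg_0 [simp]: "mdeg r 0 = 0" by (simp add: mdeg_def)

lemma mdeg_add [simp]: "mdeg r (m + n) = mdeg r m + mdeg r n"
  by (simp add: mdeg_def lookup_add sum.distrib)

lemma mdeg_single [simp]: "i \<le> r \<Longrightarrow> mdeg r (Poly_Mapping.single i n) = n"
  by (simp add: mdeg_def lookup_single when_def)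

lemma mdeg_eq_0: "Poly_Mapping.keys m \<subseteq> {..r} \<Longrightarrow> mdeg r m = 0 \<Longrightarrow> m = 0"
  by (rule poly_mapping_eqI) (auto simp: mdeg_def subset_iff in_keys_iff)

lemma keys_add_nat: "Poly_Mapping.keys (m + n) = Poly_Mapping.keys m \<union> Poly_Mapping.keys (n :: nat \<Rightarrow>\<^sub>0 nat)"
  by (auto simp: in_keys_iff lookup_add)

lemma split_var:
  assumes "Poly_Mapping.lookup m i \<noteq> 0"
  obtains n where "m = n + unitv i"
proof
  \<comment> \<open>Subtraction of exponents is truncated; it is exact here because
    \<open>x_i\<close> divides the monomial.\<close>
  show "m = (m - unitv i) + unitv i"
    using assms by (intro poly_mapping_eqI) (auto simp: lookup_add lookup_minus lookup_single when_def)
qed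

lemma split_var_deg:
  assumes "mdeg r m \<noteq> 0"
  obtains n i where "i \<le> r" "m = n + unitv i"
proof -
  from assms obtain i where "i \<le> r" "Poly_Mapping.lookup m i \<noteq> 0" by (auto simp: mdeg_def)
  with split_var that show thesis by metis
qed

text \<open>Move variables from \<open>n'\<close> to \<open>n\<close> one at a time. This is what
  makes monomials of degree divisible by \<open>d\<close> products of generators.\<close>

lemma split_deg:
  assumes "k \<le> mdeg r m"
  obtains n n' where "m = n + n'" "mdeg r n = k"
proof -
  from assms have "\<exists>n n'. m = n + n' \<and> mdeg r n = k"
  proof (induction k)
    case (Suc k)
    then obtain n n' where *: "m = n + n'" "mdeg r n = k" by auto
    with Suc.prems have "mdeg r n' \<noteq> 0" by auto
    then obtain l i where "i \<le> r" "n' = l + unitv i" by (rule split_var_deg)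
    with * have "m = (n + unitv i) + l" "mdeg r (n + unitv i) = Suc k" by (auto simp: add_ac)
    then show ?case by blast
  qed (intro exI[of _ 0] exI[of _ m], simp)
  with that show thesis by blast
qed

section \<open>Degree-preserving derivations and the monomial basis of the coordinate ring\<close>

text \<open>The derivation \<open>x\<^sub>l \<partial>/\<partial>x\<^sub>l\<close>; unlike \<open>\<partial>/\<partial>x\<^sub>l\<close> it preserves degrees, hence Veronese algebras.\<close>

definition vderiv :: "nat \<Rightarrow> ((nat \<Rightarrow>\<^sub>0 nat) \<Rightarrow>\<^sub>0 'k::field) \<Rightarrow> (nat \<Rightarrow>\<^sub>0 nat) \<Rightarrow>\<^sub>0 'k" where
  "vderiv l p = Poly_Mapping.mapp (\<lambda>m c. of_nat (Poly_Mapping.lookup m l) * c) p"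

lemma lookup_vderiv:
  "Poly_Mapping.lookup (vderiv l p) m = of_nat (Poly_Mapping.lookup m l) * Poly_Mapping.lookup p m"
  by (simp add: vderiv_def lookup_mapp when_def in_keys_iff)

lemma vderiv_add: "vderiv l (p + q) = vderiv l p + vderiv l q"
  by (rule poly_mapping_eqI) (simp add: lookup_vderiv lookup_add algebra_simps)

lemma vderiv_single:
  "vderiv l (Poly_Mapping.single m c) = Poly_Mapping.single m (of_nat (Poly_Mapping.lookup m l) * c)"
  by (rule poly_mapping_eqI) (simp add: lookup_vderiv lookup_single when_def)

lemma vderiv_const [simp]: "vderiv l (const c) = 0"
  by (simp add: vderiv_single)

lemma vderiv_mult: "vderiv l (p * q) = p * vderiv l q + q * vderiv l p"
proof (rule biadditive_eqI[where B = "\<lambda>p q. vderiv l (p * q)" and B' = "\<lambda>p q. p * vderiv l q + q * vderiv l p"])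
  fix m n :: "nat \<Rightarrow>\<^sub>0 nat" and a b :: 'a
  show "vderiv l (Poly_Mapping.single m a * Poly_Mapping.single n b) =
      Poly_Mapping.single m a * vderiv l (Poly_Mapping.single n b) + Poly_Mapping.single n b * vderiv l (Poly_Mapping.single m a)"
    by (simp add: mult_single vderiv_single lookup_add algebra_simps flip: single_add)
qed (auto intro!: additive.intro simp: vderiv_add algebra_simps)

text \<open>The condition on exponents survives all ring operations. Conversely, a monomial of
  degree \<open>d * k\<close> splits into \<open>k\<close> generators by \<open>split_deg\<close>,
  and the constants supply the coefficients.\<close>

lemma generate_ring_type_algebra_iff:
  fixes r d :: nat
  defines "G \<equiv> generate_ring ring_of_type_algebra (range const \<union> veronese_monomials r d :: ((nat \<Rightarrow>\<^sub>0 nat) \<Rightarrow>\<^sub>0 'k::field) set)"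
  shows "p \<in> G \<longleftrightarrow> (\<forall>m\<in>Poly_Mapping.keys p. Poly_Mapping.keys m \<subseteq> {..r} \<and> d dvd mdeg r m)"
    (is "_ \<longleftrightarrow> ?P p")
proof
  let ?R = "ring_of_type_algebra :: ((nat \<Rightarrow>\<^sub>0 nat) \<Rightarrow>\<^sub>0 'k) ring"
  interpret R: cring ?R by (rule cring_from_type_algebra)
  have R: "monoid.mult ?R = (*)" "one ?R = 1" "ring.zero ?R = 0" "add ?R = (+)" "carrier ?R = UNIV"
    by (simp_all add: ring_of_type_algebra_def)
  have minus: "\<ominus>\<^bsub>?R\<^esub> h = - h" for h
    using R.l_neg[of h] by (simp add: R eq_neg_iff_add_eq_0)
  show "?P p" if "p \<in> G"
    using that unfolding G_def
  proof (induction rule: generate_ring.induct)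
    case (incl h)
    then show ?case by (auto simp: veronese_monomials_def mdeg_def split: if_splits)
  next
    case (eng_add p q)
    then show ?case using keys_add[of p q] by (auto simp: R)
  next
    case (eng_mult p q)
    show ?case
    proof
      fix m assume "m \<in> Poly_Mapping.keys (p \<otimes>\<^bsub>?R\<^esub> q)"
      then obtain k l where "m = k + l" "k \<in> Poly_Mapping.keys p" "l \<in> Poly_Mapping.keys q"
        using keys_mult[of p q] by (auto simp: R)
      with eng_mult show "Poly_Mapping.keys m \<subseteq> {..r} \<and> d dvd mdeg r m"
        by (auto simp: keys_add_nat)
    qed
  next
    case (a_inv h)
    then show ?case by (auto simp: minus in_keys_iff)
  qed (auto simp: R)
  have add: "p + q \<in> G" and mult: "p * q \<in> G" if "p \<in> G" "q \<in> G" for p q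
    using that generate_ring.eng_add[of p ?R _ q] generate_ring.eng_mult[of p ?R _ q] by (auto simp: G_def R)
  have const: "const c \<in> G" for c
    unfolding G_def by (rule generate_ring.incl) auto
  have xmon: "xmon m \<in> G" if "Poly_Mapping.keys m \<subseteq> {..r}" "mdeg r m = d * k" for m k
    using that
  proof (induction k arbitrary: m)
    case 0
    then show ?case using mdeg_eq_0[of m r] const[of 1] by simp
  next
    case (Suc k)
    from Suc.prems have "d \<le> mdeg r m" by simp
    then obtain n n' where m: "m = n + n'" and n: "mdeg r n = d" by (rule split_deg)
    with Suc.prems have "xmon n \<in> G"
      unfolding G_def by (intro generate_ring.incl) (auto simp: veronese_monomials_def keys_add_nat mdeg_def)
    moreover have "xmon n' \<in> G" using Suc m n by (auto simp: keys_add_nat)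
    ultimately show ?case using mult[of "xmon n" "xmon n'"] by (simp add: m mult_single)
  qed
  have "sum f I \<in> G" if "\<And>i. i \<in> I \<Longrightarrow> f i \<in> G" for f and I :: "(nat \<Rightarrow>\<^sub>0 nat) set"
    using that const[of 0] by (induction I rule: infinite_finite_induct) (auto intro: add)
  moreover have "Poly_Mapping.single m c \<in> G" if "?P p" "m \<in> Poly_Mapping.keys p" for m c
  proof -
    have "xmon m \<in> G" using that xmon[of m] by (metis dvdE)
    then show ?thesis using mult[OF const[of c], of "xmon m"] by (simp add: mult_single)
  qed
  ultimately show "p \<in> G" if "?P p"
    using that by (subst sum_monomials[symmetric]) auto
qed

locale veronese =
  fixes r d :: nat and A :: "('k::field_char_0, (nat \<Rightarrow>\<^sub>0 nat) \<Rightarrow>\<^sub>0 'k) module"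
  assumes A_eq: "A = veronese_algebra r d"
begin

sublocale concrete_algebra A
proof (rule concrete_algebra.intro)
  show "algebra (ring_of_type_algebra :: 'k ring) A" unfolding A_eq by (rule veronese_is_algebra)
qed (simp_all add: A_eq veronese_algebra_def)

lemma smult_const: "c \<odot>\<^bsub>A\<^esub> 1 = const c"
  by (simp add: A_eq veronese_algebra_def)

lemma carrier_iff:
  "p \<in> carrier A \<longleftrightarrow> (\<forall>m\<in>Poly_Mapping.keys p. Poly_Mapping.keys m \<subseteq> {..r} \<and> d dvd mdeg r m)"
  by (simp add: A_eq veronese_algebra_def generate_ring_type_algebra_iff)

lemma carrier_const [simp]: "const c \<in> carrier A"
  by (simp add: carrier_iff)

lemma carrier_single:
  "Poly_Mapping.keys m \<subseteq> {..r} \<Longrightarrow> d dvd mdeg r m \<Longrightarrow> Poly_Mapping.single m c \<in> carrier A"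
  by (simp add: carrier_iff)

lemma carrier_vderiv: "p \<in> carrier A \<Longrightarrow> vderiv l p \<in> carrier A"
  by (auto simp: carrier_iff in_keys_iff lookup_vderiv)

text \<open>Induction along the generators instead of all monomials, suited to the Leibniz rule.
  Negation is absorbed into the product case as multiplication by \<open>const (-1)\<close>.\<close>

lemma carrier_induct [consumes 1, case_names const mon add mult]:
  assumes "p \<in> carrier A" "\<And>c. P (const c)"
    and "\<And>m. Poly_Mapping.keys m \<subseteq> {..r} \<Longrightarrow> mdeg r m = d \<Longrightarrow> P (xmon m)"
    and "\<And>p q. p \<in> carrier A \<Longrightarrow> q \<in> carrier A \<Longrightarrow> P p \<Longrightarrow> P q \<Longrightarrow> P (p + q)"
    and "\<And>p q. p \<in> carrier A \<Longrightarrow> q \<in> carrier A \<Longrightarrow> P p \<Longrightarrow> P q \<Longrightarrow> P (p * q)"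
  shows "P p"
proof -
  let ?R = "ring_of_type_algebra :: ((nat \<Rightarrow>\<^sub>0 nat) \<Rightarrow>\<^sub>0 'k) ring"
  interpret R: cring ?R by (rule cring_from_type_algebra)
  have R: "monoid.mult ?R = (*)" "one ?R = 1" "ring.zero ?R = 0" "add ?R = (+)" "carrier ?R = UNIV"
    by (simp_all add: ring_of_type_algebra_def)
  have minus: "\<ominus>\<^bsub>?R\<^esub> h = const (-1) * h" for h
    using R.l_neg[of h] by (simp add: R single_uminus eq_neg_iff_add_eq_0)
  have A: "carrier A = generate_ring ?R (range const \<union> veronese_monomials r d)"
    by (simp add: A_eq veronese_algebra_def)
  have "p \<in> generate_ring ?R (range const \<union> veronese_monomials r d)"
    using assms(1) by (simp add: A)
  then show ?thesis
  proof (induction rule: generate_ring.induct)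
    case one
    then show ?case using assms(2)[of 1] by (simp add: R)
  next
    case (incl h)
    then show ?case using assms(2,3) by (auto simp: veronese_monomials_def mdeg_def)
  next
    case (a_inv h)
    then show ?case using assms(2)[of "-1"] assms(5)[of "const (-1)" h] by (simp add: minus A[symmetric])
  next
    case (eng_add h1 h2)
    then show ?case using assms(4) by (simp add: R A[symmetric])
  next
    case (eng_mult h1 h2)
    then show ?case using assms(5) by (simp add: R A[symmetric])
  qed
qed

section \<open>Torsion in degree at least three\<close>

text \<open>Degrees in \<open>A\<close> are multiples of \<open>d\<close>, so an exponent of degree
  \<open>d\<close> splits only trivially. Thus the coefficient at \<open>s\<close> is a derivation
  over evaluation at the vertex, that is, a tangent vector there.\<close>

lemma lookup_mult_mdeg:
  assumes "p \<in> carrier A" "q \<in> carrier A" "mdeg r s = d" "s \<noteq> 0"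
  shows "Poly_Mapping.lookup (p * q) s =
    Poly_Mapping.lookup p 0 * Poly_Mapping.lookup q s + Poly_Mapping.lookup p s * Poly_Mapping.lookup q 0"
proof (rule biadditive_eqI[where B = "\<lambda>p q. Poly_Mapping.lookup (p * q) s" and
    B' = "\<lambda>p q. Poly_Mapping.lookup p 0 * Poly_Mapping.lookup q s + Poly_Mapping.lookup p s * Poly_Mapping.lookup q 0"])
  fix m n a b
  assume "m \<in> Poly_Mapping.keys p" "n \<in> Poly_Mapping.keys q"
  with assms have mn: "Poly_Mapping.keys m \<subseteq> {..r}" "Poly_Mapping.keys n \<subseteq> {..r}" "d dvd mdeg r m" "d dvd mdeg r n"
    by (auto simp: carrier_iff)
  have "m = 0 \<or> n = 0" if "m + n = s"
  proof -
    obtain i j where ij: "mdeg r m = d * i" "mdeg r n = d * j" using mn by (auto elim!: dvdE)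
    have "mdeg r m + mdeg r n = d" using that assms(3) mdeg_add by metis
    then have "d * (i + j) = d" unfolding ij by (simp add: distrib_left)
    then have "d = 0 \<or> i = 0 \<or> j = 0" by auto
    then have "mdeg r m = 0 \<or> mdeg r n = 0" using ij by auto
    then show ?thesis using mn(1,2) mdeg_eq_0 by blast
  qed
  then show "Poly_Mapping.lookup (Poly_Mapping.single m a * Poly_Mapping.single n b) s =
    Poly_Mapping.lookup (Poly_Mapping.single m a) 0 * Poly_Mapping.lookup (Poly_Mapping.single n b) s +
    Poly_Mapping.lookup (Poly_Mapping.single m a) s * Poly_Mapping.lookup (Poly_Mapping.single n b) 0"
    \<comment> \<open>For \<open>s = 0\<close> the right-hand side would count the product of the
      constant terms twice.\<close>
    using assms(4) by (auto simp: mult_single lookup_single when_def)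
qed (auto intro!: additive.intro simp: lookup_add algebra_simps)

lemma linear_form_leibniz:
  assumes "linear_form g" "x \<in> carrier A" "y \<in> carrier A"
  shows "g (dd (x * y)) = x * g (dd y) + y * g (dd x)"
proof -
  let ?u = "x *\<^sub>F dd y + y *\<^sub>F dd x"
  have F: "?u \<in> F" "dd (x * y) - ?u \<in> F" using assms by (auto intro!: F_add F_scl F_diff F_dd carrier_mult)
  have "g (dd (x * y)) = g ((dd (x * y) - ?u) + ?u)" by simp
  also have "\<dots> = g (dd (x * y) - ?u) + g ?u"
    using \<open>linear_form g\<close> F unfolding linear_form_def by blast
  also have "g (dd (x * y) - ?u) = 0"
    using \<open>linear_form g\<close> N_dd_mult[OF assms(2,3)] unfolding linear_form_def by blast
  also have "g ?u = x * g (dd y) + y * g (dd x)"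
    using assms by (simp add: linear_form_def F_scl)
  finally show ?thesis by simp
qed

lemma has_torsion_if_ge_3:
  assumes "r \<ge> 1" "d \<ge> 3"
  shows "has_torsion A \<Omega>"
proof -
  \<comment> \<open>Writing \<open>d = n + 3\<close> avoids truncated subtraction in the
    exponents.\<close>
  obtain n where d: "d = n + 3" using \<open>d \<ge> 3\<close> by (metis le_add_diff_inverse2)
  define sx :: "nat \<Rightarrow> nat \<Rightarrow> nat \<Rightarrow>\<^sub>0 nat" where "sx i j = Poly_Mapping.single 0 i + Poly_Mapping.single 1 j" for i j
  define a b c e :: "(nat \<Rightarrow>\<^sub>0 nat) \<Rightarrow>\<^sub>0 'k"
    where "a = xmon (sx (n + 3) 0)" and "b = xmon (sx (n + 2) 1)"
      and "c = xmon (sx (n + 1) 2)" and "e = xmon (sx n 3)"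
  note abce = a_def b_def c_def e_def
  have sx_eq: "sx i j = sx k l \<longleftrightarrow> i = k \<and> j = l" for i j k l
  proof
    assume "sx i j = sx k l"
    then have "Poly_Mapping.lookup (sx i j) t = Poly_Mapping.lookup (sx k l) t" for t by simp
    from this[of 0] this[of 1] show "i = k \<and> j = l" by (simp add: sx_def lookup_add lookup_single)
  qed auto
  have sx_deg: "mdeg r (sx i j) = i + j" for i j
    using \<open>r \<ge> 1\<close> by (simp add: sx_def)
  have sx_keys: "Poly_Mapping.keys (sx i j) \<subseteq> {..r}" for i j
    using \<open>r \<ge> 1\<close> by (auto simp: sx_def keys_add_nat)
  have sx_add: "sx i j + sx k l = sx (i + k) (j + l)" for i j k l
    by (simp add: sx_def single_add ac_simps)
  have sx_carr: "xmon (sx i j) \<in> carrier A" if "i + j = d" for i j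
    by (rule carrier_single[OF sx_keys]) (simp add: sx_deg that)
  have carr: "a \<in> carrier A" "b \<in> carrier A" "c \<in> carrier A" "e \<in> carrier A"
    unfolding abce by (rule sx_carr; simp add: d)+
  have carr3: "3 * b \<in> carrier A" "3 * c \<in> carrier A"
    using carr carrier_const[of 3] by (auto intro!: carrier_mult)
  have rel: "a * c = b * b" "a * e = b * c"
    unfolding abce mult_single sx_add by (rule arg_cong2[where f = Poly_Mapping.single], simp_all add: sx_eq)+
  \<comment> \<open>With \<open>t = y/x\<close> one has \<open>e/a = t^3\<close>,
    \<open>c/b = t\<close> and \<open>b = a t\<close>, so
    \<open>a de - e da = a^2 d(t^3) = 3 b^2 dt = 3 (b dc - c db)\<close> over the fraction
    field.\<close>
  define w where "w = (a *\<^sub>F dd e - e *\<^sub>F dd a) - ((3 * b) *\<^sub>F dd c - (3 * c) *\<^sub>F dd b)"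
  have F: "a *\<^sub>F dd e \<in> F" "e *\<^sub>F dd a \<in> F" "(3 * b) *\<^sub>F dd c \<in> F" "(3 * c) *\<^sub>F dd b \<in> F"
    using carr carr3 by (auto intro!: F_scl)
  have "g w = 0" if g: "linear_form g" for g
  proof -
    have diff: "g (u - v) = g u - g v" if "u \<in> F" "v \<in> F" for u v
    proof -
      have "g ((u - v) + v) = g (u - v) + g v"
        using g that F_diff[OF that] unfolding linear_form_def by blast
      then show ?thesis by simp
    qed
    have scl: "g (x *\<^sub>F dd y) = x * g (dd y)" if "x \<in> carrier A" "y \<in> carrier A" for x y
      using g that by (simp add: linear_form_def)
    have 1: "a * g (dd c) + c * g (dd a) = b * g (dd b) + b * g (dd b)"
      using linear_form_leibniz[OF g, of a c] linear_form_leibniz[OF g, of b b] carr rel by simp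
    have 2: "a * g (dd e) + e * g (dd a) = b * g (dd c) + c * g (dd b)"
      using linear_form_leibniz[OF g, of a e] linear_form_leibniz[OF g, of b c] carr rel by simp
    have gw: "g w = a * g (dd e) - e * g (dd a) - (3 * b * g (dd c) - 3 * c * g (dd b))"
      unfolding w_def using F carr carr3 by (simp add: diff F_diff scl)
    \<comment> \<open>The differentiated relations enter with coefficients \<open>a\<close> and
      \<open>- 2 * b\<close>; the last two terms vanish by the relations themselves. The nonzero
      factor \<open>a\<close> is then cancelled in the polynomial ring, a domain.\<close>
    have "a * g w = a * (a * g (dd e) + e * g (dd a) - (b * g (dd c) + c * g (dd b)))
        - 2 * b * (a * g (dd c) + c * g (dd a) - (b * g (dd b) + b * g (dd b)))
        + 2 * (b * c - a * e) * g (dd a) + 4 * (a * c - b * b) * g (dd b)"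
      unfolding gw by (simp add: algebra_simps)
    then have "a * g w = 0" unfolding 1 2 rel by simp
    moreover have "a \<noteq> 0" unfolding a_def by (metis lookup_single_eq lookup_zero one_neq_zero)
    ultimately show ?thesis by simp
  qed
  moreover have "w \<notin> N"
  proof
    let ?s = "sx (n + 3) 0" and ?t = "sx n 3"
    have "sx i j \<noteq> 0" if "i + j \<noteq> 0" for i j
      using that sx_deg[of i j] by auto
    then have s: "mdeg r ?s = d" "?s \<noteq> 0" and t: "mdeg r ?t = d" "?t \<noteq> 0"
      by (simp_all add: sx_deg d)
    \<comment> \<open>Antisymmetry in the two exponents is essential: in the Leibniz rule the terms
      containing the constant coefficient of \<open>f\<close> cancel only because of it.\<close>
    define \<psi> :: "((nat \<Rightarrow>\<^sub>0 nat) \<Rightarrow>\<^sub>0 'k) \<Rightarrow> ((nat \<Rightarrow>\<^sub>0 nat) \<Rightarrow>\<^sub>0 'k) \<Rightarrow> 'k" where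
      "\<psi> f g = Poly_Mapping.lookup f ?s * Poly_Mapping.lookup g ?t
         - Poly_Mapping.lookup f ?t * Poly_Mapping.lookup g ?s" for f g
    have add: "\<psi> (f + f') g = \<psi> f g + \<psi> f' g" "\<psi> f (g + g') = \<psi> f g + \<psi> f g'" for f f' g g'
      by (simp_all add: \<psi>_def lookup_add algebra_simps)
    assume "w \<in> N"
    have "ev \<psi> w = 0"
    proof (rule ev_vanishes_on_N[OF add(1) add(2)])
      fix f x y assume "f \<in> carrier A" "x \<in> carrier A" "y \<in> carrier A"
      then show "\<psi> f (x * y) = \<psi> (f * x) y + \<psi> (f * y) x"
        by (simp add: \<psi>_def lookup_mult_mdeg s t) (simp add: algebra_simps)
    next
      fix f k show "\<psi> f (k \<odot>\<^bsub>A\<^esub> 1) = 0"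
        using s t by (simp add: \<psi>_def smult_const lookup_single when_def)
    qed fact
    moreover have "ev \<psi> w = \<psi> a e - \<psi> e a - (\<psi> (3 * b) c - \<psi> (3 * c) b)"
      unfolding w_def using F by (simp add: ev_diff[OF add(1)] ev_dd[OF add(1)] F_diff)
    \<comment> \<open>\<open>\<psi> a e = 1\<close> and \<open>\<psi> e a = -1\<close>, while
      \<open>b\<close> and \<open>c\<close> have no coefficient at either exponent. Characteristic
      zero then gives \<open>2 \<noteq> 0\<close>.\<close>
    moreover have "\<dots> = 2"
      by (simp add: \<psi>_def abce lookup_single when_def sx_eq)
    ultimately show False by simp
  qed
  ultimately show ?thesis
    unfolding has_torsion_iff by (intro bexI[of _ w] conjI) (auto simp: w_def F F_diff)
qed

section \<open>No torsion in degrees one and two\<close>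

text \<open>The hypothesis encodes \<open>d(x^s) = \<Sum> s_l x^s dx_l/x_l\<close>. Extended
  linearly over the ground field, \<open>T\<close> rebuilds a differential modulo \<open>N\<close>
  from its images under the derivations \<open>vderiv l\<close>; if all these vanish, so does its
  class.\<close>

lemma not_has_torsion_if_lift:
  fixes T :: "nat \<Rightarrow> (nat \<Rightarrow>\<^sub>0 nat) \<Rightarrow> _"
  assumes T: "\<And>m s. Poly_Mapping.keys m \<subseteq> {..r} \<Longrightarrow> d dvd mdeg r m \<Longrightarrow> Poly_Mapping.keys s \<subseteq> {..r} \<Longrightarrow> mdeg r s = d \<Longrightarrow>
    xmon m *\<^sub>F dd (xmon s) - (\<Sum>l\<le>r. of_nat (Poly_Mapping.lookup s l) *\<^sub>F T l (m + s)) \<in> N"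
  shows "\<not> has_torsion A \<Omega>"
proof -
  \<comment> \<open>The extension of \<open>T l\<close> from monomials to polynomials, linear over
    the constants only.\<close>
  define TT where "TT l f = (\<Sum>m\<in>Poly_Mapping.keys f. const (Poly_Mapping.lookup f m) *\<^sub>F T l m)" for l f
  have TT_superset: "TT l f = (\<Sum>m\<in>S. const (Poly_Mapping.lookup f m) *\<^sub>F T l m)"
    if "finite S" "Poly_Mapping.keys f \<subseteq> S" for l f S
    unfolding TT_def using that by (intro sum.mono_neutral_left) (auto simp: in_keys_iff fun_eq_iff)
  have TT_add: "TT l (f + g) = TT l f + TT l g" for l f g
  proof -
    let ?S = "Poly_Mapping.keys f \<union> Poly_Mapping.keys g"
    have "TT l (f + g) = (\<Sum>m\<in>?S. const (Poly_Mapping.lookup (f + g) m) *\<^sub>F T l m)"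
      by (rule TT_superset) (auto simp: keys_add)
    moreover have "TT l f = (\<Sum>m\<in>?S. const (Poly_Mapping.lookup f m) *\<^sub>F T l m)"
      "TT l g = (\<Sum>m\<in>?S. const (Poly_Mapping.lookup g m) *\<^sub>F T l m)"
      by (rule TT_superset; auto)+
    ultimately show ?thesis
      by (simp add: lookup_add single_add fun_eq_iff sum_fun_apply algebra_simps sum.distrib)
  qed
  have TT_0: "TT l 0 = 0" for l by (simp add: TT_def)
  have TT_single: "TT l (Poly_Mapping.single m c) = const c *\<^sub>F T l m" for l m c
    using TT_superset[of "{m}" "Poly_Mapping.single m c" l] by simp
  have TT_sum: "TT l (sum f I) = (\<Sum>i\<in>I. TT l (f i))" for l f and I :: "'i set"
    by (rule additive.sum) (simp add: additive.intro TT_add)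
  \<comment> \<open>The defect between \<open>f dg\<close> and its reconstruction; it has to be
    shown to lie in \<open>N\<close>.\<close>
  define R where "R f g = f *\<^sub>F dd g - (\<Sum>l\<le>r. TT l (f * vderiv l g))" for f g
  have R_sum: "R (sum f I) g = (\<Sum>i\<in>I. R (f i) g)" for f g and I :: "'i set"
    unfolding R_def by (rule additive.sum[where f = "\<lambda>f. f *\<^sub>F dd g - (\<Sum>l\<le>r. TT l (f * vderiv l g))"])
      (auto intro!: additive.intro simp: TT_add algebra_simps sum.distrib fun_eq_iff)
  \<comment> \<open>Induction on \<open>g\<close> with \<open>f\<close> arbitrary, since modulo
    \<open>N\<close> the Leibniz rule turns \<open>R f (p * q)\<close> into
    \<open>R (f * p) q + R (f * q) p\<close>.\<close>
  have R: "R f g \<in> N" if "g \<in> carrier A" "f \<in> carrier A" for f g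
    using that
  proof (induction arbitrary: f rule: carrier_induct)
    case (const c)
    have "R f (Poly_Mapping.single 0 c) = f *\<^sub>F dd (c \<odot>\<^bsub>A\<^esub> 1)"
      by (simp add: R_def TT_0 smult_const fun_eq_iff sum_fun_apply)
    then show ?case
      using N_scl[OF const N_dd_const, of c] by (simp only: smult_const)
  next
    case (mon s)
    have "R (Poly_Mapping.single m c) (xmon s) \<in> N" if "m \<in> Poly_Mapping.keys f" for m c
    proof -
      have "R (Poly_Mapping.single m c) (xmon s) = const c *\<^sub>F
          (xmon m *\<^sub>F dd (xmon s) - (\<Sum>l\<le>r. of_nat (Poly_Mapping.lookup s l) *\<^sub>F T l (m + s)))"
      proof -
        have "const c * xmon m = Poly_Mapping.single m c" by (simp add: mult_single)
        then have 1: "Poly_Mapping.single m c *\<^sub>F u = const c *\<^sub>F xmon m *\<^sub>F u" for u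
          by (simp add: fun_eq_iff flip: mult.assoc)
        have "const (c * of_nat k) = const c * of_nat k" for k
          by (simp add: mult_single flip: single_of_nat)
        then have "TT l (Poly_Mapping.single m c * vderiv l (xmon s)) =
            const c *\<^sub>F of_nat (Poly_Mapping.lookup s l) *\<^sub>F T l (m + s)" for l
          by (simp add: vderiv_single mult_single TT_single fun_eq_iff mult.assoc)
        with 1 show ?thesis
          by (simp add: R_def fun_eq_iff sum_fun_apply right_diff_distrib sum_distrib_left)
      qed
      then show ?thesis
        using that mon by (auto simp: carrier_iff intro!: N_scl T)
    qed
    then show ?case
      by (subst sum_monomials[of f, symmetric]) (auto simp only: R_sum intro!: N_sum)
  next
    case (add p q)
    have "R f (p + q) = f *\<^sub>F (dd (p + q) - (dd p + dd q)) + (R f p + R f q)"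
      by (simp add: R_def vderiv_add TT_add algebra_simps sum.distrib fun_eq_iff)
    also have "\<dots> \<in> N" using add by (intro N_add N_scl N_dd_add)
    finally show ?case .
  next
    case (mult p q)
    have "R f (p * q) = f *\<^sub>F (dd (p * q) - (p *\<^sub>F dd q + q *\<^sub>F dd p)) + (R (f * p) q + R (f * q) p)"
      by (simp add: R_def vderiv_mult TT_add algebra_simps sum.distrib fun_eq_iff)
    also have "\<dots> \<in> N" using mult.hyps mult.prems by (intro N_add N_scl N_dd_mult mult.IH carrier_mult)
    finally show ?case .
  qed
  have "w \<in> N" if w: "w \<in> F" and kill: "\<And>g. linear_form g \<Longrightarrow> g w = 0" for w
  proof -
    let ?\<psi> = "\<lambda>l f x. f * vderiv l x"
    have psi_add: "?\<psi> l (f + f') x = ?\<psi> l f x + ?\<psi> l f' x" for l f f' x by (simp add: algebra_simps)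
    have "linear_form (ev (?\<psi> l))" for l
      unfolding linear_form_def
    proof (intro conjI ballI)
      fix x assume "x \<in> F"
      then show "ev (?\<psi> l) x \<in> carrier A"
        unfolding ev_def by (auto intro!: carrier_sum carrier_mult carrier_vderiv simp: mem_F)
    next
      fix x y assume "x \<in> F" "y \<in> F"
      then show "ev (?\<psi> l) (x + y) = ev (?\<psi> l) x + ev (?\<psi> l) y" by (rule ev_add[OF psi_add])
    next
      fix a x assume "x \<in> F"
      then show "ev (?\<psi> l) (a *\<^sub>F x) = a * ev (?\<psi> l) x"
        by (subst ev_superset[OF psi_add, where T = "{g. x g \<noteq> 0}"]) (auto simp: mem_F ev_def sum_distrib_left mult.assoc)
    next
      fix x assume "x \<in> N"
      then show "ev (?\<psi> l) x = 0"
        by (rule ev_vanishes_on_N[OF psi_add, rotated 3]) (auto simp: vderiv_add vderiv_mult smult_const algebra_simps)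
    qed
    then have ev0: "(\<Sum>g | w g \<noteq> 0. w g * vderiv l g) = 0" for l
      using kill[of "ev (?\<psi> l)"] by (simp add: ev_def)
    have "(\<Sum>g | w g \<noteq> 0. w g *\<^sub>F dd g) = w"
    proof
      fix x
      have "(\<Sum>g | w g \<noteq> 0. w g * dd g x) = (\<Sum>g | w g \<noteq> 0. if x = g then w g else 0)"
        by (intro sum.cong) (auto simp: dd_def)
      then show "(\<Sum>g | w g \<noteq> 0. w g *\<^sub>F dd g) x = w x"
        using w by (simp add: sum_fun_apply mem_F)
    qed
    \<comment> \<open>\<open>w\<close> is the sum of its defects and the reconstruction from its
      images under \<open>vderiv l\<close>; the images are zero by \<open>ev0\<close>.\<close>
    then have "w = (\<Sum>g | w g \<noteq> 0. R (w g) g) + (\<Sum>l\<le>r. TT l (\<Sum>g | w g \<noteq> 0. w g * vderiv l g))"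
      by (simp add: R_def TT_sum sum_subtractf sum.swap[of _ "{..r}"])
    also have "\<dots> = (\<Sum>g | w g \<noteq> 0. R (w g) g)"
      by (simp add: ev0 TT_0)
    also have "\<dots> \<in> N"
      using w by (auto intro!: N_sum R simp: mem_F) 
    finally show ?thesis .
  qed
  then show ?thesis unfolding has_torsion_iff by blast
qed

section \<open>Degree one: the polynomial ring\<close>

lemma not_has_torsion_1:
  assumes "d = 1"
  shows "\<not> has_torsion A \<Omega>"
proof (rule not_has_torsion_if_lift)
  fix m s assume "mdeg r s = d" and s: "Poly_Mapping.keys s \<subseteq> {..r}"
  then obtain i n where i: "i \<le> r" "s = n + unitv i" using \<open>d = 1\<close> by (metis split_var_deg one_neq_zero)
  then have "n = 0" using s \<open>mdeg r s = d\<close> \<open>d = 1\<close> by (auto intro: mdeg_eq_0 simp: keys_add_nat)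
  \<comment> \<open>Literally \<open>x^\<mu> dx_l/x_l\<close>. Truncation in
    \<open>\<mu> - unitv l\<close> is harmless: only \<open>l = i\<close> has a nonzero coefficient,
    and there the difference is \<open>m\<close>.\<close>
  let ?T = "\<lambda>l \<mu>. xmon (\<mu> - unitv l) *\<^sub>F dd (xmon (unitv l) :: _ \<Rightarrow>\<^sub>0 'k)"
  have "(\<Sum>l\<le>r. of_nat (Poly_Mapping.lookup s l) *\<^sub>F ?T l (m + s)) =
      (\<Sum>l\<le>r. if l = i then ?T i (m + s) else 0)"
    using i \<open>n = 0\<close> by (intro sum.cong) (auto simp: lookup_single fun_eq_iff)
  also have "\<dots> = xmon m *\<^sub>F dd (xmon s)" using i \<open>n = 0\<close> by simp
  finally show "xmon m *\<^sub>F dd (xmon s) - (\<Sum>l\<le>r. of_nat (Poly_Mapping.lookup s l) *\<^sub>F ?T l (m + s)) \<in> N"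
    by (simp only: diff_self N_0)
qed


section \<open>Degree two: lifts by polarisation\<close>

text \<open>\<open>2 x\<^sup>n x\<^sub>a x\<^sub>b dx\<^sub>i\<close> for \<open>n\<close> of odd degree, by polarisation.\<close>

definition twice_lift :: "(nat \<Rightarrow>\<^sub>0 nat) \<Rightarrow> nat \<Rightarrow> nat \<Rightarrow> nat \<Rightarrow> _ \<Rightarrow> (nat \<Rightarrow>\<^sub>0 nat) \<Rightarrow>\<^sub>0 'k" where
  "twice_lift n a b i = xmon (n + unitv b) *\<^sub>F dd (xmon (unitv a + unitv i)) + xmon (n + unitv a) *\<^sub>F dd (xmon (unitv b + unitv i))
     - xmon (n + unitv i) *\<^sub>F dd (xmon (unitv a + unitv b))"

lemma twice_lift_commute: "twice_lift n a b i = twice_lift n b a i"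
  by (simp add: twice_lift_def ac_simps)

text \<open>The quartic monomial \<open>x_a x_b x_c x_i\<close> factors into quadrics as
  \<open>Q a b * Q c i\<close> and as \<open>Q a c * Q b i\<close>. The \<open>dd (Q a i)\<close>
  terms cancel, and what remains is \<open>x^n\<close> times the difference of the two Leibniz
  expansions.\<close>

lemma twice_lift_exchange:
  assumes "d = 2" "{a, b, c, i} \<subseteq> {..r}" "Poly_Mapping.keys n \<subseteq> {..r}" "even (mdeg r n)"
  shows "twice_lift (n + unitv c) a b i - twice_lift (n + unitv b) a c i \<in> N"
proof -
  define Q :: "nat \<Rightarrow> nat \<Rightarrow> (nat \<Rightarrow>\<^sub>0 nat) \<Rightarrow>\<^sub>0 'k" where "Q x y = xmon (unitv x + unitv y)" for x y
  have carr: "Q x y \<in> carrier A" if "x \<le> r" "y \<le> r" for x y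
    unfolding Q_def using that \<open>d = 2\<close> by (intro carrier_single) (auto simp: keys_add_nat)
  let ?L = "\<lambda>x y. dd (x * y) - (x *\<^sub>F dd y + y *\<^sub>F dd x)"
  have prod: "Q a b * Q c i = Q a c * Q b i"
    by (simp add: Q_def mult_single ac_simps)
  have "twice_lift (n + unitv c) a b i - twice_lift (n + unitv b) a c i
      = (xmon n * Q b c) *\<^sub>F dd (Q a i) + (xmon n * Q a c) *\<^sub>F dd (Q b i) - (xmon n * Q c i) *\<^sub>F dd (Q a b)
       - ((xmon n * Q b c) *\<^sub>F dd (Q a i) + (xmon n * Q a b) *\<^sub>F dd (Q c i) - (xmon n * Q b i) *\<^sub>F dd (Q a c))"
    by (simp add: twice_lift_def Q_def mult_single ac_simps)
  also have "\<dots> = xmon n *\<^sub>F (?L (Q a b) (Q c i) - ?L (Q a c) (Q b i))"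
    unfolding prod by (simp add: fun_eq_iff algebra_simps)
  also have "\<dots> \<in> N"
    using assms carr by (intro N_scl N_diff N_dd_mult carrier_single) auto
  finally show ?thesis .
qed

text \<open>Exchanges connect any two factorisations. If the pairs share an index, at most one
  exchange is needed; otherwise a first exchange brings \<open>a'\<close> in. Odd degree of
  \<open>n\<close> leaves an even degree after removing one variable.\<close>

lemma twice_lift_unique:
  assumes "d = 2" "{a, b, a', b', i} \<subseteq> {..r}" "Poly_Mapping.keys n \<subseteq> {..r}" "odd (mdeg r n)"
    and eq: "n + unitv a + unitv b = n' + unitv a' + unitv b'"
  shows "twice_lift n a b i - twice_lift n' a' b' i \<in> N"
proof -
  have share: "twice_lift n a b i - twice_lift n' a b' i \<in> N"
    if "{a, b, b', i} \<subseteq> {..r}" "Poly_Mapping.keys n \<subseteq> {..r}" "odd (mdeg r n)" "n + unitv b = n' + unitv b'" for n n' a b b'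
  proof (cases "b = b'")
    case False
    have "Poly_Mapping.lookup (n + unitv b) b' \<noteq> 0" unfolding that(4) by (simp add: lookup_add)
    with False have "Poly_Mapping.lookup n b' \<noteq> 0" by (simp add: lookup_add lookup_single)
    then obtain m where m: "n = m + unitv b'" by (rule split_var)
    with that(4) have "m + unitv b + unitv b' = n' + unitv b'" by (simp add: ac_simps)
    then have "n' = m + unitv b" by simp
    then show ?thesis using that m twice_lift_exchange[OF \<open>d = 2\<close>, of a b b' i m] by (auto simp: keys_add_nat)
  qed (use that in simp)
  have cancel: "p + q = p' + q'" if "p + u + q = p' + u + q'" for p p' q q' u :: "nat \<Rightarrow>\<^sub>0 nat"
  proof -
    from that have "(p + q) + u = (p' + q') + u" by (simp only: ac_simps)
    then show ?thesis by (rule add_right_imp_eq)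
  qed
  consider "a = a'" | "a = b'" | "b = a'" | "b = b'" | "a' \<notin> {a, b}" "b' \<notin> {a, b}" by blast
  then show ?thesis
  proof cases
    case 1
    have "n + unitv b = n' + unitv b'"
      using eq unfolding 1 by (rule cancel)
    with 1 show ?thesis using share[of a b b' n n'] assms(2-4) by simp
  next
    case 2
    have "n + unitv b = n' + unitv a'"
      using eq unfolding 2 by (intro cancel[of n "unitv b'" "unitv b" n' "unitv a'"]) (simp only: ac_simps)
    with 2 show ?thesis unfolding twice_lift_commute[of n' a' b'] using share[of a b a' n n'] assms(2-4) by simp
  next
    case 3
    have "n + unitv a = n' + unitv b'"
      using eq unfolding 3 by (intro cancel[of n "unitv a'" "unitv a" n' "unitv b'"]) (simp only: ac_simps)
    with 3 show ?thesis unfolding twice_lift_commute[of n a b] using share[of b a b' n n'] assms(2-4) by simp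
  next
    case 4
    have "n + unitv a = n' + unitv a'"
      using eq unfolding 4 by (rule add_right_imp_eq)
    with 4 show ?thesis unfolding twice_lift_commute[of n a b] twice_lift_commute[of n' a' b']
      using share[of b a a' n n'] assms(2-4) by simp
  next
    case 5
    \<comment> \<open>As \<open>a'\<close> differs from \<open>a\<close> and \<open>b\<close>, it
      divides \<open>x^n\<close>, so it can be exchanged for \<open>b\<close>; the new pair shares
      \<open>a'\<close> with the target.\<close>
    have "Poly_Mapping.lookup (n + unitv a + unitv b) a' \<noteq> 0" unfolding eq by (simp add: lookup_add)
    with 5 have "Poly_Mapping.lookup n a' \<noteq> 0" by (simp add: lookup_add lookup_single)
    then obtain m where m: "n = m + unitv a'" by (rule split_var)
    have "(m + unitv b + unitv a) + unitv a' = (n' + unitv b') + unitv a'"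
      using eq unfolding m by (simp only: ac_simps)
    then have eq': "m + unitv b + unitv a = n' + unitv b'" by (rule add_right_imp_eq)
    have "twice_lift n a b i - twice_lift (m + unitv b) a a' i \<in> N"
      using twice_lift_exchange[OF \<open>d = 2\<close>, of a b a' i m] assms m by (auto simp: keys_add_nat)
    moreover have "twice_lift (m + unitv b) a' a i - twice_lift n' a' b' i \<in> N"
      using share[of a' a b' "m + unitv b" n'] eq' assms m by (auto simp: keys_add_nat)
    ultimately have "(twice_lift n a b i - twice_lift (m + unitv b) a a' i) + (twice_lift (m + unitv b) a' a i - twice_lift n' a' b' i) \<in> N"
      by (rule N_add)
    then show ?thesis by (simp add: twice_lift_commute[of _ a' a])
  qed
qed

text \<open>For fixed \<open>\<mu>\<close>, half of \<open>twice_lift\<close> gives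
  \<open>t i\<close>, well defined modulo \<open>N\<close> by \<open>twice_lift_unique\<close>.
  Degree two leaves no variable to polarise with and is treated separately.\<close>

lemma twice_lift_exists:
  assumes "d = 2"
  shows "\<exists>t. \<forall>m i j. i \<le> r \<longrightarrow> j \<le> r \<longrightarrow> Poly_Mapping.keys m \<subseteq> {..r} \<longrightarrow> even (mdeg r m) \<longrightarrow> \<mu> = m + (unitv i + unitv j) \<longrightarrow>
    xmon m *\<^sub>F dd (xmon (unitv i + unitv j)) - (t i + t j) \<in> N"
proof -
  define h where "h = const (1 / 2 :: 'k)"
  have h: "h * x + h * x = x" for x
  proof -
    have "h + h = 1" by (simp add: h_def flip: single_add)
    then show ?thesis by (simp flip: distrib_right)
  qed
  then have hF: "h *\<^sub>F u + h *\<^sub>F u = u" for u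
    by (intro ext) (simp only: plus_fun_apply scl_apply)
  show ?thesis
  proof (cases "mdeg r \<mu> = 2")
    case True
    \<comment> \<open>Here \<open>m = 0\<close> is forced and only the sum \<open>t i + t j\<close>
      is prescribed, so every \<open>t i\<close> can be half of
      \<open>dd (xmon \<mu>)\<close>.\<close>
    have "xmon m *\<^sub>F dd (xmon (unitv i + unitv j)) - (h *\<^sub>F dd (xmon \<mu>) + h *\<^sub>F dd (xmon \<mu>)) \<in> N"
      if "i \<le> r" "j \<le> r" "Poly_Mapping.keys m \<subseteq> {..r}" "\<mu> = m + (unitv i + unitv j)" for m i j
    proof -
      have "m = 0" using that True by (intro mdeg_eq_0[of m r]) auto
      then have "xmon m *\<^sub>F dd (xmon (unitv i + unitv j)) - (h *\<^sub>F dd (xmon \<mu>) + h *\<^sub>F dd (xmon \<mu>)) = 0"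
        unfolding hF using that(4) by (simp add: fun_eq_iff)
      then show ?thesis by (simp only: N_0)
    qed
    then show ?thesis by (intro exI[of _ "\<lambda>_. h *\<^sub>F dd (xmon \<mu>)"]) blast
  next
    case False
    \<comment> \<open>The factorisations \<open>x^\<mu> = x^n x_i x_a x_b\<close>, for which
      \<open>twice_lift n a b i\<close> stands for \<open>2 x^\<mu> dx_i/x_i\<close>.\<close>
    define rep where "rep i n a b \<longleftrightarrow> i \<le> r \<and> a \<le> r \<and> b \<le> r \<and> Poly_Mapping.keys n \<subseteq> {..r} \<and> odd (mdeg r n) \<and>
       \<mu> = n + unitv i + unitv a + unitv b" for i n a b
    have "\<exists>t. \<forall>n a b. rep i n a b \<longrightarrow> h *\<^sub>F twice_lift n a b i - t \<in> N" for i
    proof (cases "\<exists>n a b. rep i n a b")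
      case True
      then obtain n a b where *: "rep i n a b" by blast
      have "h *\<^sub>F twice_lift n' a' b' i - h *\<^sub>F twice_lift n a b i \<in> N" if "rep i n' a' b'" for n' a' b'
      proof -
        have "n' + unitv a' + unitv b' + unitv i = n + unitv a + unitv b + unitv i"
          using * that by (simp add: rep_def ac_simps)
        then have "twice_lift n' a' b' i - twice_lift n a b i \<in> N"
          using * that by (intro twice_lift_unique assms) (auto simp: rep_def)
        then have "h *\<^sub>F (twice_lift n' a' b' i - twice_lift n a b i) \<in> N"
          by (intro N_scl) (simp_all add: h_def)
        moreover have "h *\<^sub>F (twice_lift n' a' b' i - twice_lift n a b i) = h *\<^sub>F twice_lift n' a' b' i - h *\<^sub>F twice_lift n a b i"
          by (simp add: fun_eq_iff algebra_simps)
        ultimately show ?thesis by simp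
      qed
      then show ?thesis by blast
    qed blast
    then obtain t where t: "\<And>i n a b. rep i n a b \<Longrightarrow> h *\<^sub>F twice_lift n a b i - t i \<in> N" by metis
    have "xmon m *\<^sub>F dd (xmon (unitv i + unitv j)) - (t i + t j) \<in> N"
      if ij: "i \<le> r" "j \<le> r" "Poly_Mapping.keys m \<subseteq> {..r}" "even (mdeg r m)" "\<mu> = m + (unitv i + unitv j)" for m i j
    proof -
      \<comment> \<open>Splitting \<open>x_c\<close> off \<open>x^m\<close> leaves odd degree, so
        \<open>x_c\<close> and \<open>x_j\<close> serve to lift \<open>dx_i\<close>, and
        \<open>x_c\<close> and \<open>x_i\<close> to lift \<open>dx_j\<close>.\<close>
      have "mdeg r m \<noteq> 0" using False ij by auto
      then obtain n c where c: "c \<le> r" and m: "m = n + unitv c" by (rule split_var_deg)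
      have "rep i n c j" "rep j n c i"
        using ij c m by (auto simp: rep_def ac_simps keys_add_nat)
      then have "(h *\<^sub>F twice_lift n c j i - t i) + (h *\<^sub>F twice_lift n c i j - t j) \<in> N"
        by (intro N_add t)
      also have "(h *\<^sub>F twice_lift n c j i - t i) + (h *\<^sub>F twice_lift n c i j - t j) = (h *\<^sub>F twice_lift n c j i + h *\<^sub>F twice_lift n c i j) - (t i + t j)"
        by simp
      also have "h *\<^sub>F twice_lift n c j i + h *\<^sub>F twice_lift n c i j = xmon m *\<^sub>F dd (xmon (unitv i + unitv j))"
      proof
        fix x
        \<comment> \<open>The terms with \<open>d(x_c x_i)\<close> and \<open>d(x_c x_j)\<close>
          cancel, leaving \<open>x^m d(x_i x_j)\<close> twice.\<close>
        have "twice_lift n c j i x + twice_lift n c i j x = xmon m * dd (xmon (unitv i + unitv j)) x + xmon m * dd (xmon (unitv i + unitv j)) x"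
          by (simp add: twice_lift_def m ac_simps)
        then have "h * (twice_lift n c j i x + twice_lift n c i j x) = xmon m * dd (xmon (unitv i + unitv j)) x"
          by (simp only: distrib_left h)
        then show "(h *\<^sub>F twice_lift n c j i + h *\<^sub>F twice_lift n c i j) x = (xmon m *\<^sub>F dd (xmon (unitv i + unitv j))) x"
          by (simp add: distrib_left)
      qed
      finally show ?thesis .
    qed
    then show ?thesis by blast
  qed
qed

lemma not_has_torsion_2:
  assumes "d = 2"
  shows "\<not> has_torsion A \<Omega>"
proof -
  obtain t where t: "\<And>\<mu> m i j. i \<le> r \<Longrightarrow> j \<le> r \<Longrightarrow> Poly_Mapping.keys m \<subseteq> {..r} \<Longrightarrow> even (mdeg r m) \<Longrightarrow> \<mu> = m + (unitv i + unitv j) \<Longrightarrow>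
    xmon m *\<^sub>F dd (xmon (unitv i + unitv j)) - (t \<mu> i + t \<mu> j) \<in> N"
    using twice_lift_exists[OF assms] by metis
  show ?thesis
  proof (rule not_has_torsion_if_lift[where T = "\<lambda>l \<mu>. t \<mu> l"])
    fix m s
    assume *: "Poly_Mapping.keys m \<subseteq> {..r}" "d dvd mdeg r m" "mdeg r s = d" and s: "Poly_Mapping.keys s \<subseteq> {..r}"
    have "mdeg r s \<noteq> 0" using * assms by simp
    then obtain n i where i: "i \<le> r" "s = n + unitv i" by (rule split_var_deg)
    then have "mdeg r n = 1" using * assms by simp
    then obtain l j where j: "j \<le> r" "n = l + unitv j" by (metis split_var_deg one_neq_zero)
    then have "mdeg r l = 0" using \<open>mdeg r n = 1\<close> by simp
    moreover have "Poly_Mapping.keys l \<subseteq> {..r}" using s by (simp add: i j keys_add_nat)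
    ultimately have s_eq: "s = unitv i + unitv j" using mdeg_eq_0[of l r] by (simp add: i j ac_simps)
    \<comment> \<open>Two separate indicator terms, so that \<open>i = j\<close> correctly yields
      the coefficient 2.\<close>
    have "(\<Sum>l\<le>r. of_nat (Poly_Mapping.lookup s l) *\<^sub>F t (m + s) l) =
        (\<Sum>l\<le>r. (if l = i then t (m + s) i else 0) + (if l = j then t (m + s) j else 0))"
      by (intro sum.cong) (auto simp: s_eq lookup_add lookup_single fun_eq_iff)
    also have "\<dots> = t (m + s) i + t (m + s) j"
      using i j by (simp add: sum.distrib)
    finally show "xmon m *\<^sub>F dd (xmon s) - (\<Sum>l\<le>r. of_nat (Poly_Mapping.lookup s l) *\<^sub>F t (m + s) l) \<in> N"
      using t[OF i(1) j(1) *(1), of "m + s"] * assms by (simp only: s_eq)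
  qed
qed

end

theorem proposition4p1:
  fixes r d :: nat
  assumes "r \<ge> 1" and "d \<ge> 1"
  shows "has_torsion (veronese_algebra r d :: ('k::field_char_0, _) module)
           (kaehler_differentials (ring_of_type_algebra :: 'k ring) (veronese_algebra r d))
         \<longleftrightarrow> d \<ge> 3"
proof -
  interpret veronese r d "veronese_algebra r d :: ('k, _) module"
    by (rule veronese.intro) (rule refl)
  consider "d = 1" | "d = 2" | "d \<ge> 3" using assms(2) by linarith
  then show ?thesis
    by cases (use not_has_torsion_1 not_has_torsion_2 has_torsion_if_ge_3 assms(1) in auto)
qed

end
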